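(* The function field of $\mathcal{Y}_3$ is $\mathbb{C}(\mathcal{Y}_3)=\mathbb{C}(u,v)$, where $$u=\frac{2a(ab+b^2+b+a+1)}{b(a+b+1)},\qquad v=\frac{a^3}{b(a+b+1)}$$ (regarded as functions on the curve $\bar{\mathcal{Y}}_3$ of the context, where they satisfy $2u+v-16=0$). Moreover, $u$ and $v$ can be computed explicitly in terms of the absolute invariants $i_1,i_2,i_3$, i.e. they can be expressed as rational functions of $i_1,i_2,i_3$.
   Context: $\mathcal{M}_2$ is the moduli space of genus 2 curves over $\mathbb{C}$. A degree 5 cover $\psi:C\to E$ from a genus 2 curve to a genus 1 curve induces a degree 5 cover $\phi:\mathbb{P}^1\to\mathbb{P}^1$ with $\phi\circ\pi_C=\pi_E\circ\psi$, where $\pi_C:C\to\mathbb{P}^1$, $\pi_E:E\to\mathbb{P}^1$ are the natural degree 2 covers. $\mathcal{Y}_3\subset\mathcal{M}_2$ is the locus of genus 2 curves $C$ admitting a degree 5 cover $\psi:C\to E$ to a genus 1 curve such that $\phi$ is of degenerate type III, i.e. has exactly four branch points, with ramification indices $>1$ over them given by $((2)^2,(2)^2,(2)^2,(3))$. Let $\bar{\mathcal{Y}}_3$ be the genus 1 curve in the $(a,b)$-plane given by $$a^3+4ba^2+4a^2-12ba+4ab^2+4a-16b-16b^2=0.$$ Put $\varphi(X)=X\,F_1(X)^2/F_2(X)^2$ with $F_1(X)=X^2+(2a+2b+a^2)X+2ab+b^2$, $F_2(X)=(2a+1)X^2+(a^2+2ab+2b)X+b^2$. On $\bar{\mathcal{Y}}_3$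 the polynomial $F_4(X)=(2a+1)X^2+(2b-2ba-2a-a^2)X+b^2+2ab$ has the double root $z=\frac{a^2+2ab+2a-2b}{2(2a+1)}$, the numerator of $\varphi(X)-\varphi(z)$ is a nonzero constant times $(X-z)^2g_3(X)$ with $g_3$ a cubic, and the curves in $\mathcal{Y}_3$ are those of the form $y^2=x(x-1)g_3(x)$ for (nondegenerate) $(a,b)\in\bar{\mathcal{Y}}_3$. The absolute invariants of a genus 2 curve are $i_1=144J_4/J_2^2$, $i_2=-1728(J_2J_4-3J_6)/J_2^3$, $i_3=486J_{10}/J_2^5$, where $J_2,J_4,J_6,J_{10}$ are the classical (Igusa) invariants of binary sextics. The function field $\mathbb{C}(\mathcal{Y}_3)$ is regarded as the subfield of the function field $\mathbb{C}(\bar{\mathcal{Y}}_3)=\mathbb{C}(a,b)$ generated by the absolute invariants $i_1,i_2,i_3$ of this curve. *)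

theory Defs
  imports
    "HOL-Computational_Algebra.Computational_Algebra"
    "HOL-Computational_Algebra.Field_as_Ring"
    "Subresultants.Resultant_Prelim"
begin

section \<open>The function field of the plane curve\<close>

text \<open>
  \<open>\<complex>[a,b]\<close> is \<^typ>\<open>complex poly poly\<close>: the inner variable is \<open>a\<close>, the outer one is \<open>b\<close>.
\<close>

definition poly_a :: "complex poly poly" where "poly_a = [:[:0, 1:]:]"
definition poly_b :: "complex poly poly" where "poly_b = [:0, 1:]"

definition curve :: "complex poly poly" where
  "curve = poly_a^3 + 4 * poly_b * poly_a^2 + 4 * poly_a^2 - 12 * poly_b * poly_a
     + 4 * poly_a * poly_b^2 + 4 * poly_a - 16 * poly_b - 16 * poly_b^2"

lemma curve_expand:
  "curve = [: [:0, 4, 4, 1:], [:-16, -12, 4:], [:-16, 4:] :]"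
  by (simp add: curve_def poly_a_def poly_b_def power2_eq_square power3_eq_cube
      numeral_poly)

lemma curve_nonzero [simp]: "curve \<noteq> 0"
  by (simp add: curve_expand)

lemma degree_curve: "degree curve = 2"
  by (simp add: curve_expand)

lemma irreducible_curve: "irreducible curve"
proof (rule irreducibleI)
  show "curve \<noteq> 0" by simp
  show "\<not> curve dvd 1"
  proof
    assume "curve dvd 1"
    then have "degree curve \<le> degree (1 :: complex poly poly)" by (rule dvd_imp_degree_le) simp
    then show False by (simp add: degree_curve)
  qed
next
  have const: "is_unit p" if pq: "curve = p * q" and deg: "degree p = 0"
    for p q :: "complex poly poly"
  proof -
    from deg obtain r where r: "p = [:r:]" by (metis degree_eq_zeroE)
    have "coeff curve k = r * coeff q k" for k unfolding pq r by simp
    then have dvd: "r dvd coeff curve k" for k by simp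
    have "r dvd [:-16, 4:]" "r dvd [:0, 4, 4, 1:]"
      using dvd[of 2] dvd[of 0] by (simp_all add: curve_expand numeral_2_eq_2)
    then have "r dvd 4 * [:0, 4, 4, 1:] - [:-16, 4:] * [:36, 8, 1:]"
      by (intro dvd_diff dvd_mult dvd_mult2)
    also have "4 * [:0, 4, 4, 1:] - [:-16, 4:] * [:36, 8, 1:] = ([:576:] :: complex poly)"
      by (simp add: numeral_poly)
    finally have "r dvd [:576:]" .
    moreover have "is_unit ([:576:] :: complex poly)" by (simp add: is_unit_triv)
    ultimately have "is_unit r" using dvd_trans by blast
    then show "is_unit p" by (simp add: r is_unit_const_poly_iff)
  qed
  fix p q :: "complex poly poly"
  assume pq: "curve = p * q"
  then have nz: "p \<noteq> 0" "q \<noteq> 0" by auto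
  have deg: "degree p + degree q = 2"
    using degree_mult_eq[OF nz] pq degree_curve by simp
  consider "degree p = 0" | "degree q = 0" | "degree p = 1" "degree q = 1"
    using deg by linarith
  then show "is_unit p \<or> is_unit q"
  proof cases
    case 1
    then show ?thesis using const[OF pq] by simp
  next
    case 2
    then show ?thesis using const[of q p] pq by (simp add: mult.commute)
  next
    case 3
    obtain p0 p1 where p: "p = [:p0, p1:]"
      using 3(1) by (metis degree1_coeffs One_nat_def)
    obtain q0 q1 where q: "q = [:q0, q1:]"
      using 3(2) by (metis degree1_coeffs One_nat_def)
    have "[: [:0, 4, 4, 1:], [:-16, -12, 4:], [:-16, 4:] :] = [:p0, p1:] * [:q0, q1:]"
      using pq unfolding p q curve_expand .
    then have c: "p0 * q0 = [:0, 4, 4, 1:]" "p0 * q1 + p1 * q0 = [:-16, -12, 4:]"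
        "p1 * q1 = [:-16, 4:]"
      by (simp_all add: algebra_simps)
    have "(p0 * q1 - p1 * q0)^2 = (p0 * q1 + p1 * q0)^2 - 4 * (p0 * q0) * (p1 * q1)"
      by (simp add: algebra_simps power2_eq_square)
    also have "\<dots> = [:256, 640, 208, -96:]"
      unfolding c by (simp add: power2_eq_square numeral_poly)
    finally have "degree ((p0 * q1 - p1 * q0)^2) = 3" by simp
    moreover have "even (degree ((p0 * q1 - p1 * q0)^2))"
      by (cases "p0 * q1 - p1 * q0 = 0") (simp_all add: degree_power_eq)
    ultimately show ?thesis by simp
  qed
qed

lemma prime_curve: "prime_elem curve"
  using irreducible_curve by (rule irreducible_imp_prime_elem)

definition curve_cong :: "complex poly poly \<Rightarrow> complex poly poly \<Rightarrow> bool" where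
  "curve_cong p q \<longleftrightarrow> curve dvd p - q"

lemma curve_cong_refl: "curve_cong p p"
  by (simp add: curve_cong_def)

lemma curve_cong_sym: "curve_cong p q \<Longrightarrow> curve_cong q p"
  unfolding curve_cong_def by (subst minus_diff_eq [symmetric]) (simp only: dvd_minus_iff)

lemma curve_cong_trans:
  assumes "curve_cong p q" "curve_cong q r"
  shows "curve_cong p r"
proof -
  have "curve dvd (p - q) + (q - r)"
    using assms unfolding curve_cong_def by (rule dvd_add)
  then show ?thesis by (simp add: curve_cong_def)
qed

lemma curve_cong_add:
  assumes "curve_cong p p'" "curve_cong q q'"
  shows "curve_cong (p + q) (p' + q')"
proof -
  have "curve dvd (p - p') + (q - q')"
    using assms unfolding curve_cong_def by (rule dvd_add)
  also have "(p - p') + (q - q') = (p + q) - (p' + q')" by (rule add_diff_add [symmetric])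
  finally show ?thesis by (simp add: curve_cong_def)
qed

lemma curve_cong_minus:
  assumes "curve_cong p q"
  shows "curve_cong (- p) (- q)"
proof -
  have "curve dvd q - p" using curve_cong_sym[OF assms] by (simp add: curve_cong_def)
  then show ?thesis by (simp add: curve_cong_def)
qed

lemma curve_cong_mult:
  assumes "curve_cong p p'" "curve_cong q q'"
  shows "curve_cong (p * q) (p' * q')"
proof -
  have "curve dvd (p - p') * q + p' * (q - q')"
    using assms by (intro dvd_add dvd_mult dvd_mult2) (simp_all add: curve_cong_def)
  also have "(p - p') * q + p' * (q - q') = p * q - p' * q'"
    by (simp only: left_diff_distrib right_diff_distrib) simp
  finally show ?thesis by (simp add: curve_cong_def)
qed

lemma equivp_curve_cong: "equivp curve_cong"
  by (rule equivpI)
    (auto intro: reflpI sympI transpI curve_cong_refl curve_cong_sym curve_cong_trans)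

quotient_type coord_ring = "complex poly poly" / curve_cong
  by (rule equivp_curve_cong)

instantiation coord_ring :: comm_ring_1
begin

lift_definition zero_coord_ring :: coord_ring is 0 .
lift_definition one_coord_ring :: coord_ring is 1 .

lift_definition plus_coord_ring :: "coord_ring \<Rightarrow> coord_ring \<Rightarrow> coord_ring" is "(+)"
  by (rule curve_cong_add)
lift_definition uminus_coord_ring :: "coord_ring \<Rightarrow> coord_ring" is uminus
  by (rule curve_cong_minus)
lift_definition minus_coord_ring :: "coord_ring \<Rightarrow> coord_ring \<Rightarrow> coord_ring" is "\<lambda>p q. p + - q"
  by (intro curve_cong_add curve_cong_minus)
lift_definition times_coord_ring :: "coord_ring \<Rightarrow> coord_ring \<Rightarrow> coord_ring" is "(*)"
  by (rule curve_cong_mult)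

instance
proof
  show "(0 :: coord_ring) \<noteq> 1"
    using prime_elem_not_unit[OF prime_curve] by transfer (simp add: curve_cong_def)
next
  fix x y z :: coord_ring
  show "x * y * z = x * (y * z)" "x * y = y * x" "1 * x = x" "(x + y) * z = x * z + y * z"
    "x + y + z = x + (y + z)" "x + y = y + x" "0 + x = x" "- x + x = 0" "x - y = x + - y"
    by (transfer; simp add: curve_cong_refl algebra_simps)+
qed

end

instance coord_ring :: idom
proof
  fix x y :: coord_ring
  assume "x \<noteq> 0" "y \<noteq> 0"
  then show "x * y \<noteq> 0"
    by transfer (simp add: curve_cong_def prime_elem_dvd_mult_iff[OF prime_curve])
qed

type_synonym function_field = "coord_ring fract"

definition of_poly_ab :: "complex poly poly \<Rightarrow> function_field" where
  "of_poly_ab p = Fract (abs_coord_ring p) 1"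

definition const :: "complex \<Rightarrow> function_field" where
  "const c = of_poly_ab [:[:c:]:]"

definition fun_a :: function_field where "fun_a = of_poly_ab poly_a"
definition fun_b :: function_field where "fun_b = of_poly_ab poly_b"

lemma of_poly_ab_0 [simp]: "of_poly_ab 0 = 0"
  by (simp add: of_poly_ab_def fract_collapse flip: zero_coord_ring.abs_eq)
lemma of_poly_ab_1 [simp]: "of_poly_ab 1 = 1"
  by (simp add: of_poly_ab_def fract_collapse flip: one_coord_ring.abs_eq)
lemma of_poly_ab_add [simp]: "of_poly_ab (p + q) = of_poly_ab p + of_poly_ab q"
  by (simp add: of_poly_ab_def flip: plus_coord_ring.abs_eq)
lemma of_poly_ab_mult [simp]: "of_poly_ab (p * q) = of_poly_ab p * of_poly_ab q"
  by (simp add: of_poly_ab_def flip: times_coord_ring.abs_eq)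
lemma of_poly_ab_diff [simp]: "of_poly_ab (p - q) = of_poly_ab p - of_poly_ab q"
  using minus_coord_ring.abs_eq[of p q] by (simp add: of_poly_ab_def)
lemma of_poly_ab_power [simp]: "of_poly_ab (p ^ n) = of_poly_ab p ^ n"
  by (induction n) simp_all
lemma of_poly_ab_of_nat [simp]: "of_poly_ab (of_nat n) = of_nat n"
  by (induction n) simp_all
lemma of_poly_ab_numeral [simp]: "of_poly_ab (numeral n) = numeral n"
  using of_poly_ab_of_nat[of "numeral n"] by (simp del: of_poly_ab_of_nat)

lemma of_poly_ab_eq_0_iff: "of_poly_ab p = 0 \<longleftrightarrow> curve dvd p"
proof -
  have "of_poly_ab p = 0 \<longleftrightarrow> abs_coord_ring p = 0"
    by (simp add: of_poly_ab_def Zero_fract_def eq_fract)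
  also have "\<dots> \<longleftrightarrow> curve dvd p"
    by (simp add: zero_coord_ring.abs_eq coord_ring.abs_eq_iff curve_cong_def)
  finally show ?thesis .
qed

lemma curve_equation:
  "fun_a^3 + 4 * fun_b * fun_a^2 + 4 * fun_a^2 - 12 * fun_b * fun_a
     + 4 * fun_a * fun_b^2 + 4 * fun_a - 16 * fun_b - 16 * fun_b^2 = 0"
  using of_poly_ab_eq_0_iff[of curve] by (simp add: curve_def fun_a_def fun_b_def)

lemma of_poly_ab_nonzero:
  assumes "poly (poly curve [:\<beta>:]) \<alpha> = 0" "poly (poly p [:\<beta>:]) \<alpha> \<noteq> 0"
  shows "of_poly_ab p \<noteq> 0"
proof
  assume "of_poly_ab p = 0"
  then obtain q where "p = curve * q" by (auto simp: of_poly_ab_eq_0_iff)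
  with assms show False by simp
qed


section \<open>Subfields generated over the constants\<close>

definition subfield_over_C :: "function_field set \<Rightarrow> bool" where
  "subfield_over_C L \<longleftrightarrow> range const \<subseteq> L \<and>
     (\<forall>x\<in>L. \<forall>y\<in>L. x + y \<in> L \<and> x * y \<in> L) \<and> (\<forall>x\<in>L. - x \<in> L \<and> inverse x \<in> L)"

definition adjoin_C :: "function_field set \<Rightarrow> function_field set" where
  "adjoin_C S = \<Inter>{L. subfield_over_C L \<and> S \<subseteq> L}"

text \<open>
  Evaluation of a polynomial over \<open>\<complex>\<close> in three variables; \<open>x\<close> replaces the innermost one.
\<close>

definition eval3 :: "complex poly poly poly \<Rightarrow>
    function_field \<Rightarrow> function_field \<Rightarrow> function_field \<Rightarrow> function_field" where
  "eval3 p x y z =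
     poly (map_poly (\<lambda>q. poly (map_poly (\<lambda>r. poly (map_poly const r) x) q) y) p) z"

definition rational_function_of ::
    "function_field \<Rightarrow> function_field \<Rightarrow> function_field \<Rightarrow> function_field \<Rightarrow> bool" where
  "rational_function_of w x y z \<longleftrightarrow>
     (\<exists>p q. eval3 q x y z \<noteq> 0 \<and> w = eval3 p x y z / eval3 q x y z)"


section \<open>Invariants of binary sextics\<close>

text \<open>
  A polynomial \<open>f\<close> of degree at most 6 stands for the binary sextic
  \<open>\<Sum>k\<le>6. coeff f k * X^k * Z^(6-k)\<close>; degree 5 means a simple root at infinity.
  Writing the form as a product of six linear forms and \<open>(ij)\<close> for the determinant
  of the \<open>i\<close>-th and \<open>j\<close>-th of them, the invariants below are
  \<open>J2 = \<Sum> (12)\<^sup>2(34)\<^sup>2(56)\<^sup>2\<close> (15 terms),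
  \<open>J4 = \<Sum> (12)\<^sup>2(23)\<^sup>2(31)\<^sup>2(45)\<^sup>2(56)\<^sup>2(64)\<^sup>2\<close> (10 terms),
  \<open>J6 = \<Sum> (12)\<^sup>2(23)\<^sup>2(31)\<^sup>2(45)\<^sup>2(56)\<^sup>2(64)\<^sup>2(14)\<^sup>2(25)\<^sup>2(36)\<^sup>2\<close> (60 terms) and
  \<open>J10 = \<Prod>i<j. (ij)\<^sup>2\<close>, i.e. the invariants \<open>A, B, C, D\<close> of Igusa and Clebsch.
\<close>

definition J2 :: "'a :: field poly \<Rightarrow> 'a" where
  "J2 f = (let a0 = coeff f 0; a1 = coeff f 1; a2 = coeff f 2; a3 = coeff f 3;
               a4 = coeff f 4; a5 = coeff f 5; a6 = coeff f 6 in
     6*a3^2 - 16*a2*a4 + 40*a1*a5 - 240*a0*a6)"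

definition J4 :: "'a :: field poly \<Rightarrow> 'a" where
  "J4 f = (let a0 = coeff f 0; a1 = coeff f 1; a2 = coeff f 2; a3 = coeff f 3;
               a4 = coeff f 4; a5 = coeff f 5; a6 = coeff f 6 in
     4*a2^2*a4^2 - 12*a1*a3*a4^2 + 48*a0*a4^3 - 12*a2^2*a3*a5 + 36*a1*a3^2*a5 +
     4*a1*a2*a4*a5 - 180*a0*a3*a4*a5 - 80*a1^2*a5^2 + 300*a0*a2*a5^2 + 48*a2^3*a6 -
     180*a1*a2*a3*a6 + 324*a0*a3^2*a6 + 300*a1^2*a4*a6 - 504*a0*a2*a4*a6 -
     540*a0*a1*a5*a6 + 1620*a0^2*a6^2)"

definition J6 :: "'a :: field poly \<Rightarrow> 'a" where
  "J6 f = (let a0 = coeff f 0; a1 = coeff f 1; a2 = coeff f 2; a3 = coeff f 3;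
               a4 = coeff f 4; a5 = coeff f 5; a6 = coeff f 6 in
     8*a2^2*a3^2*a4^2 - 24*a1*a3^3*a4^2 - 24*a2^3*a4^3 + 76*a1*a2*a3*a4^3 +
     60*a0*a3^2*a4^3 - 36*a1^2*a4^4 - 160*a0*a2*a4^4 - 24*a2^2*a3^3*a5 + 72*a1*a3^4*a5 +
     76*a2^3*a3*a4*a5 - 238*a1*a2*a3^2*a4*a5 - 198*a0*a3^3*a4*a5 + 28*a1*a2^2*a4^2*a5 +
     26*a1^2*a3*a4^2*a5 + 492*a0*a2*a3*a4^2*a5 + 616*a0*a1*a4^3*a5 - 36*a2^4*a5^2 +
     26*a1*a2^2*a3*a5^2 + 176*a1^2*a3^2*a5^2 + 330*a0*a2*a3^2*a5^2 + 64*a1^2*a2*a4*a5^2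
     - 640*a0*a2^2*a4*a5^2 - 1860*a0*a1*a3*a4*a5^2 - 900*a0^2*a4^2*a5^2 - 320*a1^3*a5^3
     + 1600*a0*a1*a2*a5^3 + 2250*a0^2*a3*a5^3 + 60*a2^3*a3^2*a6 - 198*a1*a2*a3^3*a6 +
     162*a0*a3^4*a6 - 160*a2^4*a4*a6 + 492*a1*a2^2*a3*a4*a6 + 330*a1^2*a3^2*a4*a6 -
     468*a0*a2*a3^2*a4*a6 - 640*a1^2*a2*a4^2*a6 + 424*a0*a2^2*a4^2*a6 -
     876*a0*a1*a3*a4^2*a6 - 96*a0^2*a4^3*a6 + 616*a1*a2^3*a5*a6 - 1860*a1^2*a2*a3*a5*a6
     - 876*a0*a2^2*a3*a5*a6 + 1818*a0*a1*a3^2*a5*a6 + 1600*a1^3*a4*a5*a6 +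
     3472*a0*a1*a2*a4*a5*a6 + 3060*a0^2*a3*a4*a5*a6 - 2240*a0*a1^2*a5^2*a6 -
     18600*a0^2*a2*a5^2*a6 - 900*a1^2*a2^2*a6^2 - 96*a0*a2^3*a6^2 + 2250*a1^3*a3*a6^2 +
     3060*a0*a1*a2*a3*a6^2 - 10044*a0^2*a3^2*a6^2 - 18600*a0*a1^2*a4*a6^2 +
     20664*a0^2*a2*a4*a6^2 + 59940*a0^2*a1*a5*a6^2 - 119880*a0^3*a6^3)"

text \<open>
  The discriminant of the sextic form. For degree 6 it is the usual discriminant
  \<open>- Res(f, f') / a6\<close>. For degree 5 the root at infinity contributes a factor \<open>a5\<^sup>2\<close> to the
  discriminant \<open>Res(f, f') / a5\<close> of the quintic, and for smaller degree infinity is a multiple root.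
\<close>

definition J10 :: "'a :: field poly \<Rightarrow> 'a" where
  "J10 f = (if degree f = 6 then - resultant f (pderiv f) / lead_coeff f
            else if degree f = 5 then lead_coeff f * resultant f (pderiv f)
            else 0)"

definition abs_inv1 :: "'a :: field poly \<Rightarrow> 'a" where
  "abs_inv1 f = 144 * J4 f / J2 f ^ 2"

definition abs_inv2 :: "'a :: field poly \<Rightarrow> 'a" where
  "abs_inv2 f = - 1728 * (J2 f * J4 f - 3 * J6 f) / J2 f ^ 3"

definition abs_inv3 :: "'a :: field poly \<Rightarrow> 'a" where
  "abs_inv3 f = 486 * J10 f / J2 f ^ 5"


section \<open>The generic curve of the family\<close>

definition F1 :: "function_field poly" where
  "F1 = [: 2 * fun_a * fun_b + fun_b^2, 2 * fun_a + 2 * fun_b + fun_a^2, 1 :]"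

definition F2 :: "function_field poly" where
  "F2 = [: fun_b^2, fun_a^2 + 2 * fun_a * fun_b + 2 * fun_b, 2 * fun_a + 1 :]"

definition F4 :: "function_field poly" where
  "F4 = [: fun_b^2 + 2 * fun_a * fun_b,
           2 * fun_b - 2 * fun_b * fun_a - 2 * fun_a - fun_a^2, 2 * fun_a + 1 :]"

definition phi :: "function_field \<Rightarrow> function_field" where
  "phi x = x * poly F1 x ^ 2 / poly F2 x ^ 2"

definition z0 :: function_field where
  "z0 = (fun_a^2 + 2 * fun_a * fun_b + 2 * fun_a - 2 * fun_b) / (2 * (2 * fun_a + 1))"

text \<open>
  \<open>phi X - phi z0 = numer_phi / F2\<^sup>2\<close>; a constant factor in the numerator does not affect the
  absolute invariants.
\<close>

definition numer_phi :: "function_field poly" where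
  "numer_phi = [:0, 1:] * F1^2 - Polynomial.smult (phi z0) (F2^2)"

definition g3 :: "function_field poly" where
  "g3 = numer_phi div [:- z0, 1:]^2"

lemma two_a_plus_1_nonzero: "2 * fun_a + 1 \<noteq> 0"
proof -
  have "of_poly_ab (2 * poly_a + 1) \<noteq> 0"
    by (rule of_poly_ab_nonzero[of 1 2]) (simp_all add: poly_a_def curve_expand)
  then show ?thesis by (simp add: fun_a_def)
qed

lemma numeral_nonzero: "(numeral n :: function_field) \<noteq> 0"
  using of_poly_ab_nonzero[of 1 2 "numeral n"] by (simp add: curve_expand)

lemma z0_eq:
  "2 * (2 * fun_a + 1) * z0 = fun_a^2 + 2 * fun_a * fun_b + 2 * fun_a - 2 * fun_b"
proof -
  have "2 * (2 * fun_a + 1) \<noteq> 0"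
    using numeral_nonzero two_a_plus_1_nonzero by (simp only: mult_eq_0_iff) simp
  then show ?thesis
    unfolding z0_def times_divide_eq_right by (rule nonzero_mult_div_cancel_left)
qed

lemma F4_double_root: "F4 = Polynomial.smult (2 * fun_a + 1) ([:- z0, 1:]^2)"
proof -
  define a b where "a = fun_a" and "b = fun_b"
  define d where "d = 2 * a + 1"
  have d: "d \<noteq> 0" using two_a_plus_1_nonzero by (simp add: d_def a_def)
  have z: "2 * d * z0 = a^2 + 2 * a * b + 2 * a - 2 * b"
    using z0_eq by (simp only: d_def a_def b_def)
  have C: "a^3 + 4 * b * a^2 + 4 * a^2 - 12 * b * a + 4 * a * b^2 + 4 * a - 16 * b - 16 * b^2 = 0"
    using curve_equation by (simp add: a_def b_def)
  have "(2 * d * z0)^2 = 4 * d * (b^2 + 2 * a * b)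
      + a * (a^3 + 4 * b * a^2 + 4 * a^2 - 12 * b * a + 4 * a * b^2 + 4 * a - 16 * b - 16 * b^2)"
    unfolding z unfolding d_def by (simp add: algebra_simps power2_eq_square power3_eq_cube)
  then have "(2 * 2 * d) * (d * z0^2) = (2 * 2 * d) * (b^2 + 2 * a * b)"
    unfolding C by (simp add: algebra_simps power2_eq_square)
  then have c0: "d * z0^2 = b^2 + 2 * a * b" using d numeral_nonzero by simp
  have "2 * b - 2 * b * a - 2 * a - a^2 = - (2 * d * z0)" unfolding z by (simp add: algebra_simps)
  then show ?thesis
    using c0 by (simp add: F4_def d_def a_def b_def power2_eq_square algebra_simps)
qed

lemma poly_F2_z0_nonzero: "poly F2 z0 \<noteq> 0"
proof
  define a b where "a = fun_a" and "b = fun_b"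
  define d where "d = 2 * a + 1"
  define n where "n = a^2 + 2 * a * b + 2 * a - 2 * b"
  have d: "d \<noteq> 0" using two_a_plus_1_nonzero by (simp add: d_def a_def)
  have z: "2 * d * z0 = n"
    using z0_eq by (simp only: d_def a_def b_def n_def)
  assume "poly F2 z0 = 0"
  then have "b^2 + z0 * (a^2 + 2 * a * b + 2 * b) + z0^2 * d = 0"
    by (simp add: F2_def a_def b_def d_def power2_eq_square algebra_simps)
  then have "4 * d * (b^2 + z0 * (a^2 + 2 * a * b + 2 * b) + z0^2 * d) = 0"
    by simp
  then have "4 * d * b^2 + 2 * (2 * d * z0) * (a^2 + 2 * a * b + 2 * b) + (2 * d * z0)^2 = 0"
    by (simp add: algebra_simps power2_eq_square)
  then have "4 * d * b^2 + 2 * n * (a^2 + 2 * a * b + 2 * b) + n^2 = 0"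
    unfolding z .
  moreover have "of_poly_ab (let a = poly_a; b = poly_b; n = a^2 + 2 * a * b + 2 * a - 2 * b in
      4 * (2 * a + 1) * b^2 + 2 * n * (a^2 + 2 * a * b + 2 * b) + n^2) \<noteq> 0"
    by (rule of_poly_ab_nonzero[of 1 2]) (simp_all add: curve_expand poly_a_def poly_b_def Let_def)
  ultimately show False
    by (simp add: Let_def n_def d_def a_def b_def fun_a_def fun_b_def)
qed

lemma numer_phi_eq: "numer_phi = [:- z0, 1:]^2 * g3" and degree_g3: "degree g3 = 3"
proof -
  have F4z: "poly F4 z0 = 0" by (simp add: F4_double_root)
  have zero: "poly numer_phi z0 = 0"
    using poly_F2_z0_nonzero by (simp add: numer_phi_def phi_def)
  have id: "poly F1 x * poly F2 x + 2 * x * (poly (pderiv F1) x * poly F2 x - poly F1 x * poly (pderiv F2) x)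
     = poly F4 x * (x^2 + (2 * fun_b - fun_a^2) * x + fun_b^2)" for x
    unfolding F1_def F2_def F4_def
    by (simp add: pderiv_pCons power2_eq_square algebra_simps)
  have "poly (pderiv numer_phi) z0 * poly F2 z0 = poly F1 z0 *
     (poly F1 z0 * poly F2 z0 + 2 * z0 * (poly (pderiv F1) z0 * poly F2 z0 - poly F1 z0 * poly (pderiv F2) z0))"
    using poly_F2_z0_nonzero
    by (simp add: numer_phi_def phi_def pderiv_diff pderiv_mult pderiv_smult pderiv_power_Suc
        power2_eq_square field_simps pderiv_pCons)
  then have deriv: "poly (pderiv numer_phi) z0 = 0"
    using poly_F2_z0_nonzero unfolding id F4z by simp
  from zero obtain h where h: "numer_phi = [:- z0, 1:] * h"
    by (auto simp: poly_eq_0_iff_dvd elim: dvdE)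
  have "poly h z0 = 0"
    using deriv unfolding h pderiv_mult by (simp add: pderiv_pCons del: mult_pCons_left)
  then obtain k where k: "h = [:- z0, 1:] * k"
    by (auto simp: poly_eq_0_iff_dvd elim: dvdE)
  have eq: "numer_phi = [:- z0, 1:]^2 * k"
    unfolding h k by (simp only: power2_eq_square mult.assoc)
  have g3_eq: "g3 = k"
    unfolding g3_def eq by (rule nonzero_mult_div_cancel_left) simp
  show "numer_phi = [:- z0, 1:]^2 * g3" unfolding g3_eq by (rule eq)
  have "degree (Polynomial.smult (phi z0) (F2^2)) \<le> degree (F2^2)"
    by (rule degree_smult_le)
  also have "\<dots> \<le> 2 * degree F2" using degree_power_le[of F2 2] by (simp add: mult.commute)
  also have "\<dots> \<le> 4" by (simp add: F2_def)
  finally have "degree (- Polynomial.smult (phi z0) (F2^2)) < 5" by simp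
  moreover have "F1 \<noteq> 0" "degree F1 = 2" by (simp_all add: F1_def)
  then have "degree ([:0, 1:] * F1^2) = 5" by (simp add: degree_mult_eq degree_power_eq)
  ultimately have "degree numer_phi = 5"
    unfolding numer_phi_def diff_conv_add_uminus by (metis degree_add_eq_left)
  moreover have "k \<noteq> 0" using calculation eq by auto
  ultimately have "degree k = 3"
    unfolding eq by (simp add: degree_mult_eq degree_power_eq)
  then show "degree g3 = 3" by (simp add: g3_eq)
qed

text \<open>
  \<open>g3\<close> is a cubic and the division is exact: see \<open>numer_phi_eq\<close> and \<open>degree_g3\<close>.
  The generic member of the family is \<open>y\<^sup>2 = generic_curve(x)\<close>.
\<close>

definition generic_curve :: "function_field poly" where
  "generic_curve = [:0, 1:] * [:-1, 1:] * g3"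

definition inv1 :: function_field where "inv1 = abs_inv1 generic_curve"
definition inv2 :: function_field where "inv2 = abs_inv2 generic_curve"
definition inv3 :: function_field where "inv3 = abs_inv3 generic_curve"

definition function_field_Y3 :: "function_field set" where
  "function_field_Y3 = adjoin_C {inv1, inv2, inv3}"

definition fun_u :: function_field where
  "fun_u = 2 * fun_a * (fun_a * fun_b + fun_b^2 + fun_b + fun_a + 1) / (fun_b * (fun_a + fun_b + 1))"

definition fun_v :: function_field where
  "fun_v = fun_a^3 / (fun_b * (fun_a + fun_b + 1))"

end

theory Submission
  imports
    Defs
    "Subresultants.Subresultant"
begin

text \<open>
  The equation of the curve in the \<open>(a, b)\<close>-plane expresses \<open>b * (a + b + 1)\<close> through \<open>a\<close>. Hence
  \<open>v = 4 * s\<close> and \<open>u = 8 - 2 * s\<close> with \<open>s = a^2 * (4 - a) / (a + 2)^2\<close>, which gives the linear relation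
  between \<open>u\<close> and \<open>v\<close> and shows \<open>\<complex>(u, v) = \<complex>(s)\<close>. It remains to prove \<open>\<complex>(i1, i2, i3) = \<complex>(s)\<close>.

  That the invariants lie in \<open>\<complex>(s)\<close>, over which \<open>\<complex>(a, b)\<close> has degree 6, reflects symmetries of the
  family \<open>y^2 = x * (x - 1) * g3(x)\<close>. One of them, \<open>x \<mapsto> 1 - x\<close>, corresponds to \<open>b \<mapsto> - a - 1 - b\<close>. It is
  used to pass from \<open>\<complex>(a, b)\<close> to \<open>\<complex>(a)\<close>: in the coordinate \<open>x = 1/2 + k * \<eta>\<close>, with \<open>k\<close> a multiple of
  \<open>2 * b + a + 1\<close> by an element of \<open>\<complex>(a)\<close>, the sextic becomes a constant times a polynomial in \<open>\<eta>\<close> over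
  \<open>\<complex>(a)\<close> (\<open>generic_curve_eq\<close>). An affine change of the coordinate and a constant factor alter
  \<open>J2\<close>, \<open>J4\<close> and \<open>J6\<close> by powers of one element (\<open>J_affine\<close>), so these invariants can be
  read off from that polynomial, and they turn out to be functions of \<open>s\<close> times powers of
  one element \<open>U\<close> (\<open>generic_curve_invariants\<close>). For \<open>J10\<close>, which is defined by a resultant, the known
  roots 0 and 1 reduce the computation to values of \<open>g3\<close> and the discriminant of a cubic
  (\<open>J10_quintic\<close>). The powers of \<open>U\<close> cancel in the absolute invariants (\<open>inv_in_s\<close>).

  Conversely, \<open>s\<close> is a quotient of two isobaric polynomials of weight 14 in the invariants
  (\<open>s_quotient\<close>). Such a relation must exist by a count of coefficients; its denominator does
  not vanish because \<open>s\<close> is transcendental over the constants. Finally, the rational functions of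
  \<open>i1\<close>, \<open>i2\<close>, \<open>i3\<close> form a field, so that elements of the generated field are given by such
  functions (\<open>adjoin_C_imp_rational_function\<close>).
\<close>

section \<open>The function field as an extension of the complex numbers\<close>

instance coord_ring :: ring_char_0
proof
  show "inj (of_nat :: nat \<Rightarrow> coord_ring)"
  proof (rule injI)
    fix m n :: nat
    assume "of_nat m = (of_nat n :: coord_ring)"
    moreover have "of_nat k = abs_coord_ring (of_nat k)" for k
      by (induction k) (simp_all add: zero_coord_ring.abs_eq one_coord_ring.abs_eq plus_coord_ring.abs_eq)
    ultimately have "curve dvd of_nat m - of_nat n"
      by (simp add: coord_ring.abs_eq_iff curve_cong_def)
    also have "of_nat m - of_nat n = ([:[:of_nat m - of_nat n:]:] :: complex poly poly)"
      by (simp add: of_nat_poly)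
    finally have "curve dvd [:[:of_nat m - of_nat n:]:]" .
    moreover have "\<not> curve dvd p" if "p \<noteq> 0" "degree p = 0" for p
      using dvd_imp_degree_le[of curve p] that by (auto simp: degree_curve)
    ultimately have "(of_nat m :: complex) = of_nat n"
      by (metis degree_pCons_0 pCons_eq_0_iff right_minus_eq)
    then show "m = n" by simp
  qed
qed

text \<open>
  Characteristic 0 of the function field makes every numeral invertible, and lets polynomials
  over it be compared by their values.
\<close>

instance fract :: ("{idom, ring_char_0}") field_char_0
proof
  have of_nat: "of_nat k = Fract (of_nat k :: 'a) 1" for k
    by (induction k) (simp_all add: Zero_fract_def One_fract_def)
  show "inj (of_nat :: nat \<Rightarrow> 'a fract)"
    by (rule injI) (simp add: of_nat eq_fract)
qed

interpretation const: field_hom const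
proof unfold_locales
  show "const 0 = 0" "const 1 = 1"
    by (simp_all add: const_def flip: one_pCons)
  show "const (x + y) = const x + const y" "const (x * y) = const x * const y" for x y
    by (simp_all add: const_def flip: of_poly_ab_add of_poly_ab_mult)
qed

interpretation const_poly: map_poly_comm_ring_hom const ..

lemma eval_hom:
  assumes "comm_ring_hom h"
  shows "comm_ring_hom (\<lambda>p. poly (map_poly h p) x)"
proof -
  interpret h: comm_ring_hom h by fact
  interpret hp: map_poly_comm_ring_hom h ..
  show ?thesis by unfold_locales (simp_all add: hp.hom_add hp.hom_mult)
qed

lemma fun_a_eval: "poly (map_poly const p) fun_a = of_poly_ab [:p:]"
proof (induction p)
  case (pCons c p)
  have "[:pCons c p:] = [:[:c:]:] + poly_a * [:p:]" by (simp add: poly_a_def)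
  then show ?case
    using pCons by (simp only: of_poly_ab_add of_poly_ab_mult) (simp add: const_def fun_a_def)
qed simp

text \<open>
  The curve has degree 2 in \<open>b\<close>, hence divides no nonzero polynomial in \<open>a\<close> alone.
\<close>

lemma fun_a_transcendental:
  assumes "poly (map_poly const p) fun_a = 0"
  shows "p = 0"
proof (rule ccontr)
  assume "p \<noteq> 0"
  moreover have "curve dvd [:p:]" using assms by (simp add: fun_a_eval of_poly_ab_eq_0_iff)
  ultimately show False using dvd_imp_degree_le[of curve "[:p:]"] by (simp add: degree_curve)
qed

text \<open>
  The constants are algebraically closed: a root of \<open>p\<close> is a root of one of its linear
  factors.
\<close>

lemma algebraic_imp_constant:
  assumes "p \<noteq> 0" "poly (map_poly const p) x = 0"
  shows "x \<in> range const"
  using assms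
proof (induction "degree p" arbitrary: p)
  case 0
  then obtain c where "p = [:c:]" by (metis degree_eq_zeroE)
  with 0 show ?case by simp
next
  case (Suc n)
  then have "\<not> constant (poly p)" by (simp add: constant_degree)
  then obtain c where "poly p c = 0" using fundamental_theorem_of_algebra by blast
  then obtain q where q: "p = [:- c, 1:] * q" by (auto simp: poly_eq_0_iff_dvd elim: dvdE)
  then have "q \<noteq> 0" "degree q = n" using Suc by (auto simp: degree_mult_eq simp del: mult_pCons_left)
  have "map_poly const p = [:- const c, 1:] * map_poly const q"
    unfolding q by (simp only: const_poly.hom_mult) (simp add: const.hom_uminus)
  then have "x = const c \<or> poly (map_poly const q) x = 0" using Suc.prems(2) by auto
  then show ?case using Suc.hyps(1) \<open>q \<noteq> 0\<close> \<open>degree q = n\<close> by blast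
qed

lemma fun_a_linear_nonzero:
  assumes "\<alpha> \<noteq> 0"
  shows "const \<alpha> * fun_a + const \<beta> \<noteq> 0"
  using fun_a_transcendental[of "[:\<beta>, \<alpha>:]"] assms by (auto simp: algebra_simps)

lemma fun_a_nonzero:
  "fun_a \<noteq> 0" "fun_a - 2 \<noteq> 0" "fun_a + 2 \<noteq> 0" "fun_a - 4 \<noteq> 0" "3 * fun_a + 4 \<noteq> 0"
  using fun_a_linear_nonzero[of 1 0] fun_a_linear_nonzero[of 1 "-2"] fun_a_linear_nonzero[of 1 2]
    fun_a_linear_nonzero[of 1 "-4"] fun_a_linear_nonzero[of 3 4]
  by (simp_all add: const.hom_uminus const.hom_numeral)

section \<open>Subfields and rational functions\<close>

lemma adjoin_C_superset: "S \<subseteq> adjoin_C S"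
  unfolding adjoin_C_def by blast

lemma adjoin_C_least: "subfield_over_C L \<Longrightarrow> S \<subseteq> L \<Longrightarrow> adjoin_C S \<subseteq> L"
  unfolding adjoin_C_def by blast

lemma subfield_adjoin_C: "subfield_over_C (adjoin_C S)"
  unfolding subfield_over_C_def adjoin_C_def by blast

context
  fixes L assumes L: "subfield_over_C L"
begin

lemma subfield_closed:
  "const c \<in> L"
  "x \<in> L \<Longrightarrow> y \<in> L \<Longrightarrow> x + y \<in> L"
  "x \<in> L \<Longrightarrow> y \<in> L \<Longrightarrow> x * y \<in> L"
  "x \<in> L \<Longrightarrow> - x \<in> L"
  "x \<in> L \<Longrightarrow> inverse x \<in> L"
  using L unfolding subfield_over_C_def by blast+

lemma subfield_closed_derived:
  "0 \<in> L" "1 \<in> L" "numeral n \<in> L"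
  "x \<in> L \<Longrightarrow> y \<in> L \<Longrightarrow> x - y \<in> L"
  "x \<in> L \<Longrightarrow> y \<in> L \<Longrightarrow> x / y \<in> L"
  "x \<in> L \<Longrightarrow> x ^ k \<in> L"
proof -
  show "0 \<in> L" "1 \<in> L" "numeral n \<in> L"
    using subfield_closed(1)[of 0] subfield_closed(1)[of 1] subfield_closed(1)[of "numeral n"]
    by (simp_all only: const.hom_zero const.hom_one const.hom_numeral)
  then show "x \<in> L \<Longrightarrow> x ^ k \<in> L" by (induction k) (simp_all add: subfield_closed)
  show "x \<in> L \<Longrightarrow> y \<in> L \<Longrightarrow> x - y \<in> L" "x \<in> L \<Longrightarrow> y \<in> L \<Longrightarrow> x / y \<in> L"
    unfolding diff_conv_add_uminus divide_inverse by (blast intro: subfield_closed)+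
qed

end

lemma eval3_hom: "comm_ring_hom (\<lambda>p. eval3 p x y z)"
  unfolding eval3_def using const.comm_ring_hom_axioms by (intro eval_hom)

lemma eval3_const: "eval3 [:[:[:c:]:]:] x y z = const c"
  and eval3_vars: "eval3 [:[:[:0, 1:]:]:] x y z = x" "eval3 [:[:0, 1:]:] x y z = y"
    "eval3 [:0, 1:] x y z = z"
proof -
  have eval: "poly (map_poly h (pCons c p)) t = h c + t * poly (map_poly h p) t" if "h 0 = 0"
    for h :: "'b :: zero \<Rightarrow> function_field" and c p t
    using Polynomial.map_poly_pCons[of h, OF that] by simp
  show "eval3 [:[:[:c:]:]:] x y z = const c" "eval3 [:[:[:0, 1:]:]:] x y z = x"
     "eval3 [:[:0, 1:]:] x y z = y" "eval3 [:0, 1:] x y z = z"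
    unfolding eval3_def by (simp_all add: eval)
qed

text \<open>
  Membership in a generated subfield is easier to establish than explicit quotients of
  polynomials: since the quotients form a subfield, the first gives the second.
\<close>

lemma rational_functions_subfield:
  "subfield_over_C {w. rational_function_of w x y z}"
proof -
  interpret eval3: comm_ring_hom "\<lambda>p. eval3 p x y z" by (rule eval3_hom)
  let ?R = "{w. rational_function_of w x y z}"
  have I: "w \<in> ?R" if "eval3 q x y z \<noteq> 0" "w = eval3 p x y z / eval3 q x y z" for w p q
    using that unfolding rational_function_of_def by blast
  have c: "const c \<in> ?R" for c
    by (rule I[of 1 _ "[:[:[:c:]:]:]"]) (simp_all add: eval3_const)
  have b: "v + w \<in> ?R" "v * w \<in> ?R" if "v \<in> ?R" "w \<in> ?R" for v w
  proof -
    from that obtain p q p' q' where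
      v: "eval3 q x y z \<noteq> 0" "v = eval3 p x y z / eval3 q x y z" and
      w: "eval3 q' x y z \<noteq> 0" "w = eval3 p' x y z / eval3 q' x y z"
      unfolding rational_function_of_def by blast
    show "v + w \<in> ?R"
      by (rule I[of "q * q'" _ "p * q' + p' * q"])
        (use v w in \<open>simp_all add: eval3.hom_mult eval3.hom_add add_frac_eq\<close>)
    show "v * w \<in> ?R"
      by (rule I[of "q * q'" _ "p * p'"]) (use v w in \<open>simp_all add: eval3.hom_mult\<close>)
  qed
  have u: "- w \<in> ?R" "inverse w \<in> ?R" if "w \<in> ?R" for w
  proof -
    from that obtain p q where w: "eval3 q x y z \<noteq> 0" "w = eval3 p x y z / eval3 q x y z"
      unfolding rational_function_of_def by blast
    show "- w \<in> ?R" by (rule I[of q _ "- p"]) (use w in \<open>simp_all add: eval3.hom_uminus\<close>)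
    show "inverse w \<in> ?R"
    proof (cases "w = 0")
      case False
      then show ?thesis by (intro I[of p _ q]) (use w in auto)
    qed (use that in simp)
  qed
  show ?thesis
    unfolding subfield_over_C_def by (intro conjI ballI image_subsetI c b u)
qed

lemma adjoin_C_imp_rational_function:
  assumes "w \<in> adjoin_C {x, y, z}"
  shows "rational_function_of w x y z"
proof -
  interpret eval3: comm_ring_hom "\<lambda>p. eval3 p x y z" by (rule eval3_hom)
  have "rational_function_of x x y z" "rational_function_of y x y z" "rational_function_of z x y z"
    unfolding rational_function_of_def
    by (metis eval3_vars eval3.hom_one div_by_1 zero_neq_one)+
  then show ?thesis
    using adjoin_C_least[OF rational_functions_subfield, of "{x, y, z}" x y z] assms by blast
qed

section \<open>The discriminant of a quintic with two known roots\<close>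

text \<open>
  With \<open>Res(g, f)\<close> as first argument the divisor, one step of the Euclidean algorithm carries
  no sign, because \<open>Res(g, f) = lead_coeff g ^ degree f * \<Prod> f(\<gamma>)\<close> over the roots \<open>\<gamma>\<close> of \<open>g\<close>.
\<close>

lemma resultant_mod:
  fixes f g :: "'a :: field poly"
  assumes "g \<noteq> 0"
  shows "lead_coeff g ^ degree (f mod g) * resultant g f
           = lead_coeff g ^ degree f * resultant g (f mod g)"
proof (cases "degree g = 0")
  case True
  then obtain c where "g = [:c:]" by (metis degree_eq_zeroE)
  then show ?thesis by simp
next
  case False
  show ?thesis
  proof (cases "degree f < degree g")
    case True
    then have "f mod g = f" by (rule mod_poly_less)
    then show ?thesis by simp
  next
    case le: False
    define h where "h = f mod g"
    have dh: "degree h < degree g" using False degree_mod_less'[of g f] assms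
      by (cases "h = 0") (auto simp: h_def)
    have eq: "f + - (f div g) * g = h"
      using div_mult_mod_eq[of f g] by (simp add: h_def algebra_simps)
    have fg: "degree g \<le> degree f" using le by simp
    have "resultant f g = (-1) ^ (degree f * degree g) * lead_coeff g ^ (degree f - degree h)
        * resultant g h"
    proof (cases "degree h = 0")
      case True
      then obtain c where c: "h = [:c:]" by (metis degree_eq_zeroE)
      have "subresultant 0 f g = Polynomial.smult ((-1) ^ (degree f * degree g) * lead_coeff g ^ degree f
          * c ^ (degree g - 1)) h"
        using BT_lemma_1_13[OF eq fg] dh True c by simp
      then have "resultant f g = (-1) ^ (degree f * degree g) * lead_coeff g ^ degree f
          * (c ^ (degree g - 1) * c)"
        by (simp add: subresultant_resultant c)
      also have "c ^ (degree g - 1) * c = c ^ degree g"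
        using False by (metis power_minus_mult neq0_conv)
      finally show ?thesis by (simp add: c)
    next
      case False
      then have "subresultant 0 f g = Polynomial.smult ((-1) ^ (degree f * degree g)
          * lead_coeff g ^ (degree f - degree h)) (subresultant 0 g h)"
        using BT_lemma_1_12[OF eq fg, of 0] dh by simp
      then show ?thesis by (simp add: subresultant_resultant)
    qed
    then have "resultant g f = lead_coeff g ^ (degree f - degree h) * resultant g h"
      using resultant_swap[of g f] by (simp add: minus_one_power_iff)
    moreover have "lead_coeff g ^ degree f = lead_coeff g ^ degree h * lead_coeff g ^ (degree f - degree h)"
      using dh fg by (simp flip: power_add)
    ultimately show ?thesis by (simp add: h_def)
  qed
qed

lemma resultant_cong:
  fixes f f' g :: "'a :: field poly"
  assumes "g \<noteq> 0" "g dvd f - f'"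
  shows "lead_coeff g ^ degree f' * resultant g f = lead_coeff g ^ degree f * resultant g f'"
proof -
  have "f mod g = f' mod g" using assms(2) by (simp add: mod_eq_dvd_iff)
  note eqs = resultant_mod[OF assms(1), of f] resultant_mod[OF assms(1), of f', folded this]
  have "lead_coeff g ^ degree (f mod g) * (lead_coeff g ^ degree f' * resultant g f)
      = lead_coeff g ^ degree f' * (lead_coeff g ^ degree (f mod g) * resultant g f)"
    by (simp only: mult_ac)
  also have "\<dots> = lead_coeff g ^ degree (f mod g) * (lead_coeff g ^ degree f * resultant g f')"
    unfolding eqs(1) mult.left_commute[of _ _ "resultant g f'"] eqs(2) by (simp only: mult_ac)
  finally have "lead_coeff g ^ degree (f mod g) * (lead_coeff g ^ degree f' * resultant g f)
      = lead_coeff g ^ degree (f mod g) * (lead_coeff g ^ degree f * resultant g f')" .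
  then show ?thesis using assms(1) by simp
qed

text \<open>
  A root \<open>c\<close> of the first argument splits off as the value of the second one at \<open>c\<close>. The
  Euclidean algorithm proves this without a splitting field: the argument of larger degree is
  reduced modulo the other one, and both sides of the claim change by the same factor.
\<close>

lemma resultant_linear_factor:
  fixes q r :: "'a :: field poly"
  assumes "q \<noteq> 0"
  shows "resultant ([:- c, 1:] * q) r = poly r c * resultant q r"
  using assms
proof (induction "degree q + degree r" arbitrary: q r rule: less_induct)
  case less
  define f where "f = [:- c, 1:] * q"
  have "lead_coeff f = lead_coeff [:- c, 1:] * lead_coeff q"
    unfolding f_def by (rule lead_coeff_mult)
  then have f: "f \<noteq> 0" "degree f = Suc (degree q)" "lead_coeff f = lead_coeff q"
    using less.prems by (simp_all add: f_def degree_mult_eq del: mult_pCons_left)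
  have l: "lead_coeff q \<noteq> 0" using less.prems by simp
  consider "degree r = 0" | "degree q < degree r" | "0 < degree r" "degree r \<le> degree q"
    by linarith
  then have "resultant f r = poly r c * resultant q r"
  proof cases
    \<comment> \<open>the degree of \<open>f\<close> exceeds that of \<open>q\<close> by one only, so one of the two reductions is always possible\<close>
    case 1
    then obtain a where "r = [:a:]" by (metis degree_eq_zeroE)
    then show ?thesis using f(2) by simp
  next
    case 2
    define r' where "r' = r mod f"
    have "degree r' < degree r"
      using 2 f degree_mod_less'[of f r] by (cases "r' = 0") (auto simp: r'_def)
    then have IH: "resultant f r' = poly r' c * resultant q r'"
      unfolding f_def using less.hyps less.prems by simp
    have "f dvd r - r'" by (simp add: r'_def minus_mod_eq_mult_div)
    moreover have "poly f c = 0" by (simp add: f_def)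
    ultimately have c: "poly r' c = poly r c" by (auto elim!: dvdE simp: algebra_simps)
    have "q dvd r - r'" using \<open>f dvd r - r'\<close> unfolding f_def by (rule dvd_mult_right)
    from resultant_cong[OF less.prems this] resultant_cong[OF f(1) \<open>f dvd r - r'\<close>] IH c f(3)
    have "lead_coeff q ^ degree r' * resultant f r
        = lead_coeff q ^ degree r' * (poly r c * resultant q r)"
      by (simp add: mult_ac)
    then show ?thesis using l by simp
  next
    case 3
    define q' where "q' = q mod r"
    define f' where "f' = [:- c, 1:] * q'"
    have r: "r \<noteq> 0" "lead_coeff r \<noteq> 0" using 3 by auto
    have dq: "r dvd q - q'" by (simp add: q'_def minus_mod_eq_mult_div)
    have df: "r dvd f - f'"
      unfolding f_def f'_def right_diff_distrib[symmetric] using dq by (rule dvd_mult)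
    note cong = resultant_cong[OF r(1) dq] resultant_cong[OF r(1) df]
    show ?thesis
    proof (cases "q' = 0")
      case True
      with cong 3 r have "resultant r q = 0" "resultant r f = 0" by (simp_all add: f'_def)
      then show ?thesis using resultant_swap[of f r] resultant_swap[of q r] by simp
    next
      case False
      have "degree q' < degree q"
        using 3 False degree_mod_less'[of r q] r by (auto simp: q'_def)
      then have IH: "resultant f' r = poly r c * resultant q' r"
        unfolding f'_def using less.hyps False by simp
      have f': "degree f' = Suc (degree q')"
        using False by (simp add: f'_def degree_mult_eq del: mult_pCons_left)
      have "lead_coeff r ^ degree f' * resultant f r
        = (-1) ^ (degree f * degree r) * (lead_coeff r ^ degree f * resultant r f')"
        unfolding resultant_swap[of f r] cong(2)[symmetric] by (simp only: mult_ac)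
      also have "\<dots> = (-1) ^ (degree f * degree r) * (-1) ^ (degree r * degree f')
           * lead_coeff r ^ degree f * poly r c * resultant q' r"
        unfolding resultant_swap[of r f'] IH by (simp only: mult_ac)
      also have "resultant q' r = (-1) ^ (degree q' * degree r) * resultant r q'"
        by (rule resultant_swap)
      also have "(-1) ^ (degree f * degree r) * (-1) ^ (degree r * degree f')
          * lead_coeff r ^ degree f * poly r c * ((-1) ^ (degree q' * degree r) * resultant r q')
        = lead_coeff r * poly r c * (((-1) ^ (degree f * degree r) * (-1) ^ (degree r * degree f')
             * (-1) ^ (degree q' * degree r)) * (lead_coeff r ^ degree q * resultant r q'))"
        by (simp add: f(2) mult_ac)
      also have "lead_coeff r ^ degree q * resultant r q' = lead_coeff r ^ degree q' * resultant r q"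
        using cong(1) by simp
      also have "resultant r q = (-1) ^ (degree q * degree r) * resultant q r"
        unfolding mult.commute[of "degree q"] by (rule resultant_swap)
      also have "(-1) ^ (degree f * degree r) * (-1) ^ (degree r * degree f')
             * (-1) ^ (degree q' * degree r) = ((-1) ^ (degree q * degree r) :: 'a)"
        unfolding f(2) f' by (simp flip: power_add power_mult_distrib) (simp add: algebra_simps minus_one_power_iff)
      also have "lead_coeff r * poly r c * ((-1) ^ (degree q * degree r)
            * (lead_coeff r ^ degree q' * ((-1) ^ (degree q * degree r) * resultant q r)))
          = lead_coeff r ^ degree f' * (poly r c * resultant q r)"
        by (simp add: f' minus_one_power_iff)
      finally show ?thesis using r(2) by simp
    qed
  qed
  then show ?case by (simp only: f_def)
qed

definition disc_cubic :: "'a :: comm_ring_1 poly \<Rightarrow> 'a" where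
  "disc_cubic g = (let c0 = coeff g 0; c1 = coeff g 1; c2 = coeff g 2; c3 = coeff g 3 in
     c1^2 * c2^2 - 4 * c1^3 * c3 - 4 * c0 * c2^3 - 27 * c0^2 * c3^2 + 18 * c0 * c1 * c2 * c3)"

lemma disc_cubic_pCons:
  "disc_cubic [:c0, c1, c2, c3:] =
     c1^2 * c2^2 - 4 * c1^3 * c3 - 4 * c0 * c2^3 - 27 * c0^2 * c3^2 + 18 * c0 * c1 * c2 * c3"
  by (simp add: disc_cubic_def coeff_pCons numeral_eq_Suc Let_def del: power_Suc)

text \<open>
  The remainder of \<open>g\<close> modulo \<open>pderiv g\<close> is linear or constant. A linear remainder has its
  root in the ground field, and \<open>resultant_linear_factor\<close> evaluates the resultant there; a
  constant remainder occurs exactly when \<open>pderiv g\<close> is three times a square, and gives the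
  same formula.
\<close>

lemma resultant_cubic_pderiv:
  fixes c0 c1 c2 :: "'a :: field_char_0"
  defines "g \<equiv> [:c0, c1, c2, 1:]"
  shows "resultant (pderiv g) g = - disc_cubic g"
proof -
  define g' where "g' = pderiv g"
  have g': "g' = [:c1, 2 * c2, 3:]" 
    by (rule poly_eqI) (simp add: g'_def g_def coeff_pderiv coeff_pCons split: nat.split)
  define r0 r1 where "r0 = c0 - c1 * c2 / 9" and "r1 = 2 / 3 * c1 - 2 / 9 * c2^2"
  have "g - [:r0, r1:] = g' * [:c2 / 9, 1 / 3:]"
    by (simp add: g_def g' r0_def r1_def power2_eq_square field_simps)
  then have "g' dvd g - [:r0, r1:]" by (rule dvdI)
  from resultant_cong[OF _ this]
  have cong: "3 ^ degree [:r0, r1:] * resultant g' g = 3 ^ 3 * resultant g' [:r0, r1:]"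
    by (simp add: g' g_def)
  have "resultant g' g = 9 * (3 * r0^2 - 2 * c2 * r0 * r1 + c1 * r1^2)"
  proof (cases "r1 = 0")
    case True
    then show ?thesis using cong by (simp add: g' power2_eq_square)
  next
    case False
    then have "[:r0, r1:] = [:- (- r0 / r1), 1:] * [:r1:]" by simp
    then have "resultant [:r0, r1:] g' = poly g' (- r0 / r1) * resultant [:r1:] g'"
      using resultant_linear_factor[of "[:r1:]" "- r0 / r1" g'] False by simp
    also have "\<dots> = 3 * r0^2 - 2 * c2 * r0 * r1 + c1 * r1^2"
      using False by (simp add: g' field_simps power2_eq_square)
    finally have "resultant g' [:r0, r1:] = 3 * r0^2 - 2 * c2 * r0 * r1 + c1 * r1^2"
      using resultant_swap[of g' "[:r0, r1:]"] by (simp add: g')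
    then have "3 * resultant g' g = 3 * (9 * (3 * r0^2 - 2 * c2 * r0 * r1 + c1 * r1^2))"
      using cong False by simp
    then show ?thesis by (subst (asm) mult_cancel_left) simp
  qed
  also have "\<dots> = - disc_cubic g"
    unfolding g_def disc_cubic_pCons r0_def r1_def
    by (simp add: field_simps power2_eq_square power3_eq_cube)
  finally show ?thesis by (simp only: g'_def)
qed

text \<open>
  The discriminant of a product is the product of the discriminants of the factors and the
  squared resultant of any two of them. The leading coefficient 1 makes the contribution of
  the root at infinity trivial. The derivation peels off \<open>\<alpha>\<close> and \<open>\<beta>\<close> and then works modulo
  \<open>g\<close>, where \<open>pderiv f\<close> is \<open>l * pderiv g\<close>.
\<close>

lemma J10_quintic:
  fixes \<alpha> \<beta> :: "'a :: field_char_0"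
  assumes "degree g = 3" "lead_coeff g = 1"
  shows "J10 ([:- \<alpha>, 1:] * [:- \<beta>, 1:] * g)
      = (\<alpha> - \<beta>)^2 * poly g \<alpha> ^ 2 * poly g \<beta> ^ 2 * disc_cubic g"
proof -
  define l where "l = [:- \<alpha>, 1:] * [:- \<beta>, 1:]"
  define f where "f = l * g"
  have g: "g \<noteq> 0" "degree g = 3" "lead_coeff g = 1" using assms by auto
  have "g = [:coeff g 0, coeff g 1, coeff g 2, 1:]"
    using assms by (intro poly_eqI) (auto simp: coeff_pCons coeff_eq_0 numeral_eq_Suc split: nat.split)
  then have disc: "resultant (pderiv g) g = - disc_cubic g" by (metis resultant_cubic_pderiv)
  have l: "l \<noteq> 0" "degree l = 2" "lead_coeff l = 1" by (simp_all add: l_def)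
  have "lead_coeff f = lead_coeff l * lead_coeff g" unfolding f_def by (rule lead_coeff_mult)
  with g l have f: "degree f = 5" "lead_coeff f = 1" "f \<noteq> 0"
    by (simp_all add: f_def degree_mult_eq)
  have deg: "degree (pderiv f) = 4" "degree (pderiv g) = 2" "pderiv g \<noteq> 0"
    using f g pderiv_eq_0_iff[of g] by (simp_all add: degree_pderiv)
  have split: "resultant (l * p) r = poly r \<alpha> * (poly r \<beta> * resultant p r)" if "p \<noteq> 0" for p r
  proof -
    have "[:- \<beta>, 1:] * p \<noteq> 0" using that by (simp only: mult_eq_0_iff) simp
    then show ?thesis
      unfolding l_def mult.assoc
      using resultant_linear_factor[of "[:- \<beta>, 1:] * p"] resultant_linear_factor[OF that] by metis
  qed
  have roots: "poly l \<alpha> = 0" "poly l \<beta> = 0"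
      "poly (pderiv l) \<alpha> = \<alpha> - \<beta>" "poly (pderiv l) \<beta> = \<beta> - \<alpha>"
    by (simp_all add: l_def pderiv_pCons)
  have "resultant f (pderiv f) = poly (pderiv f) \<alpha> * (poly (pderiv f) \<beta> * resultant g (pderiv f))"
    using split[OF g(1)] by (simp only: f_def)
  also have "poly (pderiv f) \<alpha> = (\<alpha> - \<beta>) * poly g \<alpha>"
    by (simp add: f_def pderiv_mult roots)
  also have "poly (pderiv f) \<beta> = (\<beta> - \<alpha>) * poly g \<beta>"
    by (simp add: f_def pderiv_mult roots)
  also have "resultant g (pderiv f) = resultant g (l * pderiv g)"
  proof -
    have "g dvd pderiv f - l * pderiv g" by (simp add: f_def pderiv_mult)
    from resultant_cong[OF g(1) this] show ?thesis by (simp add: g(3))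
  qed
  also have "\<dots> = resultant (l * pderiv g) g"
    using resultant_swap[of g "l * pderiv g"] deg g l by (simp add: degree_mult_eq)
  also have "\<dots> = poly g \<alpha> * (poly g \<beta> * resultant (pderiv g) g)"
    by (rule split[OF deg(3)])
  also have "resultant (pderiv g) g = - disc_cubic g"
    by (rule disc)
  finally show ?thesis
    using f unfolding J10_def f_def[symmetric] l_def[symmetric]
    by (simp add: power2_eq_square algebra_simps)
qed

section \<open>Affine changes of the coordinate\<close>

text \<open>
  The invariants as forms in the coefficients of a quintic, over rings in which the
  coefficients may themselves be polynomials.
\<close>

definition J2_form :: "'a :: comm_ring_1 \<Rightarrow> 'a \<Rightarrow> 'a \<Rightarrow> 'a \<Rightarrow> 'a \<Rightarrow> 'a \<Rightarrow> 'a" where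
  "J2_form a0 a1 a2 a3 a4 a5 =
    6*a3^2 - 16*a2*a4 + 40*a1*a5"

definition J4_form :: "'a :: comm_ring_1 \<Rightarrow> 'a \<Rightarrow> 'a \<Rightarrow> 'a \<Rightarrow> 'a \<Rightarrow> 'a \<Rightarrow> 'a" where
  "J4_form a0 a1 a2 a3 a4 a5 =
    4*a2^2*a4^2 - 12*a1*a3*a4^2 + 48*a0*a4^3 - 12*a2^2*a3*a5 + 36*a1*a3^2*a5 + 4*a1*a2*a4*a5 -
    180*a0*a3*a4*a5 - 80*a1^2*a5^2 + 300*a0*a2*a5^2"

definition J6_form :: "'a :: comm_ring_1 \<Rightarrow> 'a \<Rightarrow> 'a \<Rightarrow> 'a \<Rightarrow> 'a \<Rightarrow> 'a \<Rightarrow> 'a" where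
  "J6_form a0 a1 a2 a3 a4 a5 =
    8*a2^2*a3^2*a4^2 - 24*a1*a3^3*a4^2 - 24*a2^3*a4^3 + 76*a1*a2*a3*a4^3 + 60*a0*a3^2*a4^3 -
    36*a1^2*a4^4 - 160*a0*a2*a4^4 - 24*a2^2*a3^3*a5 + 72*a1*a3^4*a5 + 76*a2^3*a3*a4*a5 -
    238*a1*a2*a3^2*a4*a5 - 198*a0*a3^3*a4*a5 + 28*a1*a2^2*a4^2*a5 + 26*a1^2*a3*a4^2*a5 +
    492*a0*a2*a3*a4^2*a5 + 616*a0*a1*a4^3*a5 - 36*a2^4*a5^2 + 26*a1*a2^2*a3*a5^2 +
    176*a1^2*a3^2*a5^2 + 330*a0*a2*a3^2*a5^2 + 64*a1^2*a2*a4*a5^2 - 640*a0*a2^2*a4*a5^2 -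
    1860*a0*a1*a3*a4*a5^2 - 900*a0^2*a4^2*a5^2 - 320*a1^3*a5^3 + 1600*a0*a1*a2*a5^3 +
    2250*a0^2*a3*a5^3"

lemma J_quintic:
  "J2 [:a0, a1, a2, a3, a4, a5:] = J2_form a0 a1 a2 a3 a4 a5"
  "J4 [:a0, a1, a2, a3, a4, a5:] = J4_form a0 a1 a2 a3 a4 a5"
  "J6 [:a0, a1, a2, a3, a4, a5:] = J6_form a0 a1 a2 a3 a4 a5"
  by (simp_all add: J2_def J4_def J6_def J2_form_def J4_form_def J6_form_def
      coeff_pCons numeral_eq_Suc Let_def del: power_Suc)

lemma poly_J_form:
  "poly (J2_form p0 p1 p2 p3 p4 p5) x
     = J2_form (poly p0 x) (poly p1 x) (poly p2 x) (poly p3 x) (poly p4 x) (poly p5 x)"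
  "poly (J4_form p0 p1 p2 p3 p4 p5) x
     = J4_form (poly p0 x) (poly p1 x) (poly p2 x) (poly p3 x) (poly p4 x) (poly p5 x)"
  "poly (J6_form p0 p1 p2 p3 p4 p5) x
     = J6_form (poly p0 x) (poly p1 x) (poly p2 x) (poly p3 x) (poly p4 x) (poly p5 x)"
  by (simp_all add: J2_form_def J4_form_def J6_form_def)

text \<open>
  The coefficients of \<open>f(x + t)\<close>, as polynomials in \<open>t\<close>, satisfy these differential equations.
  Invariance under translations thus amounts to an identity between the partial derivatives of
  the invariant, which has far fewer terms than the expanded translation formula.
\<close>

lemma pderiv_J_form:
  fixes p0 p1 p2 p3 p4 p5 :: "'a :: idom poly"
  assumes "pderiv p0 = p1" "pderiv p1 = 2 * p2" "pderiv p2 = 3 * p3" "pderiv p3 = 4 * p4"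
    "pderiv p4 = 5 * p5" "pderiv p5 = 0"
  shows "pderiv (J2_form p0 p1 p2 p3 p4 p5) = 0" "pderiv (J4_form p0 p1 p2 p3 p4 p5) = 0"
    "pderiv (J6_form p0 p1 p2 p3 p4 p5) = 0"
  unfolding J2_form_def J4_form_def J6_form_def
  by (simp_all add: pderiv_add pderiv_diff pderiv_mult pderiv_power_Suc assms eval_nat_numeral
      algebra_simps)

lemma pcompose_cubic:
  fixes \<alpha> \<beta> :: "'a :: comm_ring_1"
  shows "pcompose [:a0, a1, a2, a3:] [:\<beta>, \<alpha>:] =
    [: a0 + a1 * \<beta> + a2 * \<beta>^2 + a3 * \<beta>^3, \<alpha> * (a1 + 2 * a2 * \<beta> + 3 * a3 * \<beta>^2),
       \<alpha>^2 * (a2 + 3 * a3 * \<beta>), \<alpha>^3 * a3:]"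
  by (simp add: pcompose_pCons algebra_simps power2_eq_square power3_eq_cube)

lemma pcompose_quintic:
  fixes \<alpha> \<beta> :: "'a :: comm_ring_1"
  shows "pcompose [:a0, a1, a2, a3, a4, a5:] [:\<beta>, \<alpha>:] =
    [: poly [:a0, a1, a2, a3, a4, a5:] \<beta>, \<alpha> * poly [:a1, 2 * a2, 3 * a3, 4 * a4, 5 * a5:] \<beta>,
       \<alpha>^2 * poly [:a2, 3 * a3, 6 * a4, 10 * a5:] \<beta>, \<alpha>^3 * poly [:a3, 4 * a4, 10 * a5:] \<beta>,
       \<alpha>^4 * poly [:a4, 5 * a5:] \<beta>, \<alpha>^5 * poly [:a5:] \<beta>:]"
  by (simp add: pcompose_pCons algebra_simps eval_nat_numeral)

lemma J_form_translate:
  fixes a0 a1 a2 a3 a4 a5 \<beta> :: "'a :: field_char_0"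
  defines "p0 \<equiv> [:a0, a1, a2, a3, a4, a5:]" and "p1 \<equiv> [:a1, 2 * a2, 3 * a3, 4 * a4, 5 * a5:]"
    and "p2 \<equiv> [:a2, 3 * a3, 6 * a4, 10 * a5:]" and "p3 \<equiv> [:a3, 4 * a4, 10 * a5:]"
    and "p4 \<equiv> [:a4, 5 * a5:]" and "p5 \<equiv> [:a5:]"
  shows "J2_form (poly p0 \<beta>) (poly p1 \<beta>) (poly p2 \<beta>) (poly p3 \<beta>) (poly p4 \<beta>) (poly p5 \<beta>)
      = J2_form a0 a1 a2 a3 a4 a5"
    and "J4_form (poly p0 \<beta>) (poly p1 \<beta>) (poly p2 \<beta>) (poly p3 \<beta>) (poly p4 \<beta>) (poly p5 \<beta>)
      = J4_form a0 a1 a2 a3 a4 a5"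
    and "J6_form (poly p0 \<beta>) (poly p1 \<beta>) (poly p2 \<beta>) (poly p3 \<beta>) (poly p4 \<beta>) (poly p5 \<beta>)
      = J6_form a0 a1 a2 a3 a4 a5"
proof -
  have indep: "poly p \<beta> = poly p 0" if "pderiv p = 0" for p :: "'a poly"
  proof -
    from that have "degree p = 0" by (simp add: pderiv_eq_0_iff)
    then obtain c where "p = [:c:]" by (rule degree_eq_zeroE)
    then show ?thesis by simp
  qed
  have der: "pderiv p0 = p1" "pderiv p1 = 2 * p2" "pderiv p2 = 3 * p3" "pderiv p3 = 4 * p4"
    "pderiv p4 = 5 * p5" "pderiv p5 = 0"
    by (rule poly_eqI; simp add: p0_def p1_def p2_def p3_def p4_def p5_def coeff_pderiv numeral_poly
        coeff_pCons split: nat.split)+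
  have at_0: "poly p0 0 = a0" "poly p1 0 = a1" "poly p2 0 = a2" "poly p3 0 = a3" "poly p4 0 = a4"
    "poly p5 0 = a5"
    by (simp_all add: p0_def p1_def p2_def p3_def p4_def p5_def)
  show "J2_form (poly p0 \<beta>) (poly p1 \<beta>) (poly p2 \<beta>) (poly p3 \<beta>) (poly p4 \<beta>) (poly p5 \<beta>)
      = J2_form a0 a1 a2 a3 a4 a5"
    and "J4_form (poly p0 \<beta>) (poly p1 \<beta>) (poly p2 \<beta>) (poly p3 \<beta>) (poly p4 \<beta>) (poly p5 \<beta>)
      = J4_form a0 a1 a2 a3 a4 a5"
    and "J6_form (poly p0 \<beta>) (poly p1 \<beta>) (poly p2 \<beta>) (poly p3 \<beta>) (poly p4 \<beta>) (poly p5 \<beta>)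
      = J6_form a0 a1 a2 a3 a4 a5"
    using pderiv_J_form[OF der, THEN indep] by (simp_all only: poly_J_form at_0)
qed

lemma J_form_scale:
  fixes c \<alpha> :: "'a :: field"
  shows "J2_form (c * a0) (c * (\<alpha> * a1)) (c * (\<alpha>^2 * a2)) (c * (\<alpha>^3 * a3)) (c * (\<alpha>^4 * a4)) (c * (\<alpha>^5 * a5))
      = (c * \<alpha>^3)^2 * J2_form a0 a1 a2 a3 a4 a5"
    "J4_form (c * a0) (c * (\<alpha> * a1)) (c * (\<alpha>^2 * a2)) (c * (\<alpha>^3 * a3)) (c * (\<alpha>^4 * a4)) (c * (\<alpha>^5 * a5))
      = (c * \<alpha>^3)^4 * J4_form a0 a1 a2 a3 a4 a5"
    "J6_form (c * a0) (c * (\<alpha> * a1)) (c * (\<alpha>^2 * a2)) (c * (\<alpha>^3 * a3)) (c * (\<alpha>^4 * a4)) (c * (\<alpha>^5 * a5))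
      = (c * \<alpha>^3)^6 * J6_form a0 a1 a2 a3 a4 a5"
  unfolding J2_form_def J4_form_def J6_form_def by (simp_all add: algebra_simps eval_nat_numeral)

text \<open>
  An invariant of degree \<open>r\<close> has weight \<open>3 * r\<close>, so that substitution of a linear form
  multiplies it by \<open>\<alpha> ^ (3 * r)\<close>. The factors for different \<open>r\<close> are powers of one number,
  which cancels in the absolute invariants.
\<close>

lemma J_affine:
  fixes c \<alpha> \<beta> :: "'a :: field_char_0"
  assumes "degree q \<le> 5"
  shows "J2 (Polynomial.smult c (pcompose q [:\<beta>, \<alpha>:])) = (c * \<alpha>^3)^2 * J2 q"
    "J4 (Polynomial.smult c (pcompose q [:\<beta>, \<alpha>:])) = (c * \<alpha>^3)^4 * J4 q"
    "J6 (Polynomial.smult c (pcompose q [:\<beta>, \<alpha>:])) = (c * \<alpha>^3)^6 * J6 q"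
proof -
  have q: "q = [:coeff q 0, coeff q 1, coeff q 2, coeff q 3, coeff q 4, coeff q 5:]"
    using assms by (intro poly_eqI) (auto simp: coeff_pCons coeff_eq_0 numeral_eq_Suc split: nat.split)
  show "J2 (Polynomial.smult c (pcompose q [:\<beta>, \<alpha>:])) = (c * \<alpha>^3)^2 * J2 q"
    "J4 (Polynomial.smult c (pcompose q [:\<beta>, \<alpha>:])) = (c * \<alpha>^3)^4 * J4 q"
    "J6 (Polynomial.smult c (pcompose q [:\<beta>, \<alpha>:])) = (c * \<alpha>^3)^6 * J6 q"
    by (subst (1 2) q, simp only: pcompose_quintic smult_pCons smult_0_right J_quintic J_form_scale
        J_form_translate)+
qed

lemma disc_cubic_affine:
  fixes c \<alpha> \<beta> :: "'a :: idom"
  shows "disc_cubic (Polynomial.smult c (pcompose [:a0, a1, a2, a3:] [:\<beta>, \<alpha>:]))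
     = c^4 * (\<alpha>^6 * disc_cubic [:a0, a1, a2, a3:])"
  unfolding pcompose_cubic smult_pCons smult_0_right disc_cubic_pCons
  by (simp add: algebra_simps eval_nat_numeral)

section \<open>A scaled sextic over the rational function field in a\<close>

text \<open>
  With \<open>x = 1/2 + k * \<eta>\<close> and \<open>k^2 = - (3 * a + 4) / (16 * (2 * a + 1) * (a - 4))\<close>, the
  coefficients of \<open>g3\<close> as a polynomial in \<open>\<eta>\<close> come from these polynomials in \<open>a\<close>, up to a
  common factor: \<open>scaled_cubic\<close> and \<open>scaled_sextic\<close> stand for \<open>g3\<close> and \<open>x * (x - 1) * g3\<close>. All
  odd powers of \<open>k\<close> have moved into the constant factors, since \<open>k \<mapsto> - k\<close> together with
  \<open>x \<mapsto> 1 - x\<close> is a symmetry of the family.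
\<close>

definition cubic_coeff0 :: "'a :: comm_ring_1 poly" where
  "cubic_coeff0 = [:32, 56, - 56, - 124, 84, 29, - 22, 1:]"
definition cubic_coeff1 :: "'a :: comm_ring_1 poly" where
  "cubic_coeff1 = [:- 48, - 68, 40, 80, - 24, - 21, 5:]"
definition cubic_coeff2 :: "'a :: comm_ring_1 poly" where
  "cubic_coeff2 = [:24, 8, - 12, - 8, 3:]"

definition scaled_cubic :: "'a :: comm_ring_1 \<Rightarrow> 'a poly" where
  "scaled_cubic a = [: 4 * poly cubic_coeff0 a, - 4 * poly cubic_coeff1 a,
     (3 * a + 4) * poly cubic_coeff2 a, 4 * (3 * a + 4) :]"

definition scaled_sextic :: "'a :: comm_ring_1 \<Rightarrow> 'a poly" where
  "scaled_sextic a = [: 4 * (2 * a + 1) * (a - 4), 0, 3 * a + 4 :] * scaled_cubic a"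

lemma scaled_sextic_pCons:
  "scaled_sextic a =
    [: poly [:-2048, -7168, -1664, 16000, 6720, -15232, 848, 3328, -816, 32:] a,
       poly [:-3072, -9728, -3520, 11776, 6144, -6592, -1264, 1232, -160:] a,
       poly [:-1024, -3072, -1984, -64, 1760, 1120, -352, -176, 12:] a,
       poly [:512, 1024, -32, -1664, -576, 624, 172, -60:] a,
       poly [:384, 704, 216, -344, -252, 0, 27:] a,
       poly [:64, 96, 36:] a :]"
  unfolding scaled_sextic_def scaled_cubic_def cubic_coeff0_def cubic_coeff1_def cubic_coeff2_def
  by (simp add: algebra_simps)

text \<open>
  The forms evaluated at the coefficients of \<open>scaled_sextic\<close>, as an identity of polynomials in
  the indeterminate \<open>a\<close>: with coefficient lists, the simplifier multiplies out both sides
  numerically.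
\<close>

lemma J_scaled_sextic_poly:
  fixes T S W :: "'a :: {idom, ring_char_0} poly"
  defines "T \<equiv> [:0, - 16, - 12, 4, 3:]" and "S \<equiv> [:0, 0, 4, - 1:]" and "W \<equiv> [:4, 4, 1:]"
  defines "p0 \<equiv> [:-2048, -7168, -1664, 16000, 6720, -15232, 848, 3328, -816, 32:]"
    and "p1 \<equiv> [:-3072, -9728, -3520, 11776, 6144, -6592, -1264, 1232, -160:]"
    and "p2 \<equiv> [:-1024, -3072, -1984, -64, 1760, 1120, -352, -176, 12:]"
    and "p3 \<equiv> [:512, 1024, -32, -1664, -576, 624, 172, -60:]"
    and "p4 \<equiv> [:384, 704, 216, -344, -252, 0, 27:]"
    and "p5 \<equiv> [:64, 96, 36:]"
  shows "J2_form p0 p1 p2 p3 p4 p5 = 32 * T^2 * (57 * S^2 - 138 * S * W + 43 * W^2)"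
    and "J4_form p0 p1 p2 p3 p4 p5 = 64 * T^4 *
      (81 * S^4 + 11880 * S^3 * W + 1512 * S^2 * W^2 - 4080 * S * W^3 + 256 * W^4)"
    and "J6_form p0 p1 p2 p3 p4 p5 = 512 * T^6 *
      (5913 * S^6 + 974484 * S^5 * W - 1303992 * S^4 * W^2 - 714072 * S^3 * W^3
       + 1128952 * S^2 * W^4 - 315776 * S * W^5 + 13312 * W^6)"
  unfolding assms J2_form_def J4_form_def J6_form_def
  by (simp_all add: numeral_poly eval_nat_numeral)

text \<open>
  Apart from powers of \<open>T\<close> and \<open>W\<close>, the invariants depend on \<open>a\<close> only through the ratio
  \<open>S / W\<close>, a rational function of degree 3. This is where the invariants descend from \<open>\<complex>(a)\<close>
  to the smaller field \<open>\<complex>(S / W)\<close>.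
\<close>

lemma J_scaled_sextic:
  fixes a :: "'a :: field_char_0"
  defines "T \<equiv> (3 * a + 4) * a * (a - 2) * (a + 2)" and "S \<equiv> a^2 * (4 - a)" and "W \<equiv> (a + 2)^2"
  shows "J2 (scaled_sextic a) = 32 * T^2 * (57 * S^2 - 138 * S * W + 43 * W^2)"
    and "J4 (scaled_sextic a) = 64 * T^4 *
      (81 * S^4 + 11880 * S^3 * W + 1512 * S^2 * W^2 - 4080 * S * W^3 + 256 * W^4)"
    and "J2 (scaled_sextic a) * J4 (scaled_sextic a) - 3 * J6 (scaled_sextic a) = 512 * T^6 *
      (729 * S^6 - 259524 * S^5 * W - 2287116 * S^4 * W^2 + 2420712 * S^3 * W^3
       - 816264 * S^2 * W^4 + 104256 * S * W^5 + 4096 * W^6)"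
proof -
  have eval: "poly [:0, - 16, - 12, 4, 3:] a = T" "poly [:0, 0, 4, - 1:] a = S" "poly [:4, 4, 1:] a = W"
    by (simp_all add: T_def S_def W_def algebra_simps power2_eq_square)
  note J = scaled_sextic_pCons J_quintic poly_J_form [symmetric] J_scaled_sextic_poly
    poly_mult poly_add poly_diff poly_power poly_numeral eval
  show J2: "J2 (scaled_sextic a) = 32 * T^2 * (57 * S^2 - 138 * S * W + 43 * W^2)"
    by (simp only: J)
  show J4: "J4 (scaled_sextic a) = 64 * T^4 *
      (81 * S^4 + 11880 * S^3 * W + 1512 * S^2 * W^2 - 4080 * S * W^3 + 256 * W^4)"
    by (simp only: J)
  have J6: "J6 (scaled_sextic a) = 512 * T^6 *
      (5913 * S^6 + 974484 * S^5 * W - 1303992 * S^4 * W^2 - 714072 * S^3 * W^3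
       + 1128952 * S^2 * W^4 - 315776 * S * W^5 + 13312 * W^6)"
    by (simp only: J)
  show "J2 (scaled_sextic a) * J4 (scaled_sextic a) - 3 * J6 (scaled_sextic a) = 512 * T^6 *
      (729 * S^6 - 259524 * S^5 * W - 2287116 * S^4 * W^2 + 2420712 * S^3 * W^3
       - 816264 * S^2 * W^4 + 104256 * S * W^5 + 4096 * W^6)"
    unfolding J2 J4 J6 by (simp add: algebra_simps eval_nat_numeral)
qed

lemma J10_scaled_sextic_poly:
  fixes T S W R m l :: "'a :: {idom, ring_char_0} poly"
  defines "T \<equiv> [:0, - 4, 0, 1:]" and "S \<equiv> [:0, 0, 4, - 1:]" and "W \<equiv> [:4, 4, 1:]"
    and "R \<equiv> [:- 4, - 4, 7, - 2:]" and "m \<equiv> [:4, 3:]" and "l \<equiv> [:- 16, - 28, 8:]"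
  shows "l * (m * (4 * cubic_coeff0 - l * cubic_coeff2)^2 + l * (4 * cubic_coeff1 + l * 4)^2)^2
      * disc_cubic [:4 * cubic_coeff0, - 4 * cubic_coeff1, m * cubic_coeff2, 4 * m:]
    = - 63700992 * m * T^10 * (S^2 * R * W^7)"
  unfolding disc_cubic_pCons assms cubic_coeff0_def cubic_coeff1_def cubic_coeff2_def
  by (simp add: numeral_poly eval_nat_numeral)

text \<open>
  The squared factor in front of the discriminant of the cubic is, up to a power of \<open>m\<close>, the
  square of the product of the values of the cubic at the roots of the quadratic factor of
  \<open>scaled_sextic\<close>: the values at the two roots \<open>\<plusminus> r\<close> are \<open>p \<mp> r * q\<close> with
  \<open>p = 4 * n0 - l * n2\<close> and \<open>q = 4 * n1 + 4 * l\<close>, and \<open>m * r^2 = - l\<close>.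
\<close>

lemma J10_scaled_sextic:
  fixes a :: "'a :: field_char_0"
  defines "T \<equiv> a * (a - 2) * (a + 2)" and "S \<equiv> a^2 * (4 - a)" and "W \<equiv> (a + 2)^2"
    and "n0 \<equiv> poly cubic_coeff0 a" and "n1 \<equiv> poly cubic_coeff1 a" and "n2 \<equiv> poly cubic_coeff2 a"
    and "m \<equiv> 3 * a + 4" and "l \<equiv> 4 * (2 * a + 1) * (a - 4)"
  shows "l * (m * (4 * n0 - l * n2)^2 + l * (4 * n1 + l * 4)^2)^2 * disc_cubic (scaled_cubic a)
    = - 63700992 * m * T^10 * (S^2 * (2 * S - W) * W^7)"
proof -
  have eval: "poly [:0, - 4, 0, 1:] a = T" "poly [:0, 0, 4, - 1:] a = S" "poly [:4, 4, 1:] a = W"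
    "poly [:- 4, - 4, 7, - 2:] a = 2 * S - W" "poly [:4, 3:] a = m" "poly [:- 16, - 28, 8:] a = l"
    by (simp_all add: T_def S_def W_def m_def l_def algebra_simps power2_eq_square)
  show ?thesis
    using arg_cong[OF J10_scaled_sextic_poly, of "\<lambda>p. poly p a"]
    unfolding scaled_cubic_def disc_cubic_pCons m_def[symmetric]
    by (simp only: poly_mult poly_add poly_diff poly_minus poly_power poly_numeral eval
        n0_def n1_def n2_def)
qed

section \<open>The cubic factor of the generic curve\<close>

text \<open>
  The curve equation is quadratic in \<open>b\<close>, and its two solutions are exchanged by
  \<open>b \<mapsto> - a - 1 - b\<close>, that is, by \<open>k \<mapsto> - k\<close>. The denominator of \<open>k\<close> is chosen so that the
  double root \<open>z0\<close> of \<open>F4\<close> has the coordinate \<open>\<eta> = 2 * (a - 1)\<close> with respect to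
  \<open>x = 1/2 + k * \<eta>\<close>.
\<close>

definition fun_k :: function_field where
  "fun_k = (2 * fun_b + fun_a + 1) / (4 * (2 * fun_a + 1))"

text \<open>
  \<open>A\<close>, \<open>B\<close> and \<open>C\<close> are the parts of \<open>F1\<close> and \<open>F2\<close> that are even and odd in \<open>k\<close>, cleared of
  denominators: \<open>16 * d * e * F1 = A + 16 * d * e * k * B\<close> and \<open>16 * e * F2 = C\<close>. This and the
  next identity are the parts of the factorisation of \<open>phi X - phi z0\<close> that are even and odd
  in \<open>k\<close>.
\<close>

lemma numerator_even:
  fixes a \<eta> :: "'a :: comm_ring_1"
  defines "m \<equiv> 3 * a + 4" and "d \<equiv> 2 * a + 1" and "e \<equiv> a - 4"
  defines "A \<equiv> - m * \<eta>^2 - 4 * a^2 * d * e - 4 * d^2 * m - 4 * d * m * \<eta>"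
    and "B \<equiv> (a^2 + a) * \<eta> + 2 * d * a" and "C \<equiv> - m * \<eta>^2 - 4 * (a + 1) * m * \<eta> + 4 * a^2 * e - 4 * d * m"
  shows "A^2 - 16 * m * d * e * B^2 - 4 * m * \<eta> * A * B = (d * C)^2"
  unfolding A_def B_def C_def m_def d_def e_def by (simp add: algebra_simps power2_eq_square)

lemma numerator_odd:
  fixes a \<eta> :: "'a :: comm_ring_1"
  defines "m \<equiv> 3 * a + 4" and "d \<equiv> 2 * a + 1" and "e \<equiv> a - 4"
  defines "A \<equiv> - m * \<eta>^2 - 4 * a^2 * d * e - 4 * d^2 * m - 4 * d * m * \<eta>"
    and "B \<equiv> (a^2 + a) * \<eta> + 2 * d * a" and "C \<equiv> - m * \<eta>^2 - 4 * (a + 1) * m * \<eta> + 4 * a^2 * e - 4 * d * m"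
    and "q \<equiv> 3 * a^4 - 8 * a^3 - 12 * a^2 - 72 * a + 8"
  shows "64 * d * e * A * B + 4 * \<eta> * (A^2 - 16 * m * d * e * B^2) + q * C^2 = m * (\<eta> - 2 * (a - 1))^2 * poly (scaled_cubic a) \<eta>"
  unfolding A_def B_def C_def m_def d_def e_def q_def scaled_cubic_def cubic_coeff0_def cubic_coeff1_def cubic_coeff2_def poly_pCons poly_0
  by (simp add: algebra_simps eval_nat_numeral)

text \<open>
  The factorisation of the numerator of \<open>phi X - phi z0\<close>, with \<open>a\<close> and \<open>k\<close> as parameters of
  the curve. Here \<open>t\<close> is the value that makes it true; that \<open>t = phi z0\<close> follows afterwards by
  putting \<open>x = z\<close>.
\<close>

lemma numerator_factor:
  fixes a k x :: "'a :: field_char_0"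
  defines "b \<equiv> 2 * (2 * a + 1) * k - (a + 1) / 2"
    and "t \<equiv> 1 / 2 - k * (3 * a^4 - 8 * a^3 - 12 * a^2 - 72 * a + 8) / (4 * (2 * a + 1)^2)"
    and "z \<equiv> 1 / 2 + 2 * k * (a - 1)"
  assumes d: "2 * a + 1 \<noteq> 0" and e: "a - 4 \<noteq> 0" and m: "3 * a + 4 \<noteq> 0"
    and k: "16 * (2 * a + 1) * (a - 4) * k^2 = - (3 * a + 4)"
  shows "x * (x^2 + (2 * a + 2 * b + a^2) * x + (2 * a * b + b^2))^2
       - t * ((2 * a + 1) * x^2 + (a^2 + 2 * a * b + 2 * b) * x + b^2)^2
     = (x - z)^2 * (k^3 / (4 * (3 * a + 4)) * poly (scaled_cubic a) ((x - 1 / 2) / k))"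
proof -
  have k0: "k \<noteq> 0" using k m by (metis mult_zero_right neg_equal_0_iff_equal power_zero_numeral)
  define \<eta> where "\<eta> = (x - 1 / 2) / k"
  have x: "x = 1 / 2 + k * \<eta>" using k0 by (simp add: \<eta>_def)
  define d e m where "d = 2 * a + 1" and "e = a - 4" and "m = 3 * a + 4"
  \<comment> \<open>multiplication by \<open>M\<close> turns \<open>k^2\<close> into the polynomial \<open>- m\<close>\<close>
  define M where "M = 16 * d * e"
  have de: "d \<noteq> 0" "m \<noteq> 0" "e \<noteq> 0" using d e m by (simp_all add: d_def e_def m_def)
  then have nz: "d \<noteq> 0" "m \<noteq> 0" "M \<noteq> 0" by (simp_all add: M_def)
  have k': "M * k^2 = - m" using k by (simp add: M_def d_def e_def m_def)
  define A where "A = - m * \<eta>^2 - 4 * a^2 * d * e - 4 * d^2 * m - 4 * d * m * \<eta>"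
  define B where "B = (a^2 + a) * \<eta> + 2 * d * a"
  define C where "C = - m * \<eta>^2 - 4 * (a + 1) * m * \<eta> + 4 * a^2 * e - 4 * d * m"
  define q where "q = 3 * a^4 - 8 * a^3 - 12 * a^2 - 72 * a + 8"
  define c where "c = poly (scaled_cubic a) \<eta>"
  define f1 f2 where "f1 = x^2 + (2 * a + 2 * b + a^2) * x + (2 * a * b + b^2)"
    and "f2 = (2 * a + 1) * x^2 + (a^2 + 2 * a * b + 2 * b) * x + b^2"
  have "M * f1 = A + M * k * B + (M * k^2 + m) * (\<eta>^2 + 4 * d * \<eta> + 4 * d^2)"
    unfolding M_def f1_def x b_def A_def B_def d_def e_def m_def 
    by (simp add: field_simps power2_eq_square)
  then have f1: "M * f1 = A + M * k * B" using k' by simp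
  have "16 * e * f2 = C + (M * k^2 + m) * (\<eta>^2 + 4 * (a + 1) * \<eta> + 4 * d)"
    unfolding M_def f2_def x b_def C_def d_def e_def m_def 
    by (simp add: field_simps power2_eq_square)
  then have "16 * e * f2 = C" using k' by simp
  then have f2: "M * f2 = d * C" by (simp add: M_def mult_ac)
  have even: "A^2 - m * M * B^2 - 4 * m * \<eta> * A * B = (d * C)^2"
    using numerator_even[of a \<eta>, folded d_def e_def m_def, folded A_def B_def C_def]
    by (simp add: M_def mult_ac)
  have odd: "4 * M * A * B + 4 * \<eta> * (A^2 - m * M * B^2) + q * C^2 = m * (\<eta> - 2 * (a - 1))^2 * c"
    using numerator_odd[of a \<eta>, folded d_def e_def m_def, folded A_def B_def C_def q_def c_def]
    by (simp add: M_def mult_ac)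
  have t': "t = 1 / 2 - k * q / (4 * d^2)" by (simp only: t_def q_def d_def)
  have t: "t * (d * C)^2 = (d * C)^2 / 2 - k * (q * C^2) / 4"
    unfolding t' using nz by (simp add: field_simps)
  \<comment> \<open>separate the even from the odd powers of \<open>k\<close>; the even part equals \<open>(d * C)^2 / 2\<close> and cancels\<close>
  have "M^2 * (x * f1^2 - t * f2^2) = x * (M * f1)^2 - t * (M * f2)^2"
    by (simp add: power_mult_distrib algebra_simps)
  also have "\<dots> = x * (A^2 + M * (M * k^2) * B^2 + 2 * M * k * A * B) - t * (d * C)^2"
    unfolding f1 f2 by (simp add: power2_eq_square algebra_simps)
  also have "\<dots> = x * (A^2 - m * M * B^2 + 2 * M * k * A * B) - t * (d * C)^2"
    unfolding k' by (simp add: mult_ac)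
  also have "\<dots> = (A^2 - m * M * B^2) / 2 + 2 * (M * k^2) * \<eta> * A * B
      + k / 4 * (4 * M * A * B + 4 * \<eta> * (A^2 - m * M * B^2)) - t * (d * C)^2"
    unfolding x by (simp add: field_simps power2_eq_square)
  also have "\<dots> = (A^2 - m * M * B^2 - 4 * m * \<eta> * A * B) / 2
      + k / 4 * (4 * M * A * B + 4 * \<eta> * (A^2 - m * M * B^2)) - t * (d * C)^2"
    unfolding k' by (simp add: field_simps)
  also have "\<dots> = k / 4 * (4 * M * A * B + 4 * \<eta> * (A^2 - m * M * B^2) + q * C^2)"
    unfolding even t by (simp add: field_simps)
  also have "\<dots> = (M * k^2)^2 * k * (\<eta> - 2 * (a - 1))^2 * c / (4 * m)"
    unfolding odd k' using nz by (simp add: field_simps power2_eq_square)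
  also have "\<dots> = M^2 * ((k * \<eta> - 2 * k * (a - 1))^2 * (k^3 / (4 * m) * c))"
    by (simp add: field_simps power2_eq_square power3_eq_cube)
  also have "k * \<eta> - 2 * k * (a - 1) = x - z" by (simp add: x z_def)
  finally have "M^2 * (x * f1^2 - t * f2^2) = M^2 * ((x - z)^2 * (k^3 / (4 * m) * c))" .
  then have "x * f1^2 - t * f2^2 = (x - z)^2 * (k^3 / (4 * m) * c)"
    using nz(3) by (simp only: mult_cancel_left power_eq_0_iff) simp
  then show ?thesis by (simp only: f1_def f2_def c_def m_def \<eta>_def)
qed

lemma curve_completed_square:
  fixes a b :: "'a :: comm_ring_1"
  shows "(a - 4) * (2 * b + a + 1)^2 + (2 * a + 1) * (3 * a + 4)
    = a^3 + 4 * b * a^2 + 4 * a^2 - 12 * b * a + 4 * a * b^2 + 4 * a - 16 * b - 16 * b^2"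
  by (simp add: algebra_simps eval_nat_numeral)

lemma fun_k_square: "16 * (2 * fun_a + 1) * (fun_a - 4) * fun_k^2 = - (3 * fun_a + 4)"
proof -
  define h where "h = 2 * fun_b + fun_a + 1"
  define d where "d = 2 * fun_a + 1"
  have d: "d \<noteq> 0" using two_a_plus_1_nonzero by (simp add: d_def)
  have "(fun_a - 4) * h^2 + d * (3 * fun_a + 4) = 0"
    unfolding h_def d_def by (simp only: curve_completed_square curve_equation)
  then have h: "(fun_a - 4) * h^2 = - (d * (3 * fun_a + 4))" by (simp only: eq_neg_iff_add_eq_0)
  have "d * (16 * d * (fun_a - 4) * fun_k^2) = (fun_a - 4) * h^2"
    using d unfolding fun_k_def h_def[symmetric] d_def[symmetric]
    by (simp add: power_divide power_mult_distrib power2_eq_square)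
  also have "\<dots> = d * - (3 * fun_a + 4)" unfolding h by (rule mult_minus_right [symmetric])
  finally show ?thesis using d unfolding d_def by (simp only: mult_cancel_left) simp
qed

lemma fun_k_nonzero: "fun_k \<noteq> 0"
  using fun_k_square fun_a_nonzero(5)
  by (metis mult_zero_right neg_equal_0_iff_equal power_zero_numeral)

lemma fun_b_eq: "fun_b = 2 * (2 * fun_a + 1) * fun_k - (fun_a + 1) / 2"
proof -
  have "2 * (2 * fun_a + 1) * fun_k = (2 * fun_b + fun_a + 1) / 2"
    unfolding fun_k_def times_divide_eq_right
    by (subst frac_eq_eq) (use two_a_plus_1_nonzero in \<open>simp_all only: mult_eq_0_iff\<close>, simp_all add: algebra_simps)
  then show ?thesis by (simp add: field_simps)
qed

lemma z0_in_k: "z0 = 1 / 2 + 2 * fun_k * (fun_a - 1)"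
proof -
  have "2 * (2 * fun_a + 1) * z0 = 2 * (2 * fun_a + 1) * (1 / 2 + 2 * fun_k * (fun_a - 1))"
    unfolding z0_eq unfolding fun_b_eq by (simp add: field_simps power2_eq_square)
  moreover have "2 * (2 * fun_a + 1) \<noteq> 0" using two_a_plus_1_nonzero by (simp only: mult_eq_0_iff) simp
  ultimately show ?thesis by (simp only: mult_cancel_left) simp
qed

text \<open>
  At \<open>x = z0\<close> the factorisation reads \<open>z0 * F1(z0)^2 = t * F2(z0)^2\<close>, which identifies \<open>t\<close> as
  \<open>phi z0\<close>.
\<close>

lemma phi_z0:
  "phi z0 = 1 / 2 - fun_k * (3 * fun_a^4 - 8 * fun_a^3 - 12 * fun_a^2 - 72 * fun_a + 8)
       / (4 * (2 * fun_a + 1)^2)" (is "_ = ?t")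
  and poly_numer_phi: "poly numer_phi x = (x - z0)^2
     * (fun_k^3 / (4 * (3 * fun_a + 4)) * poly (scaled_cubic fun_a) ((x - 1 / 2) / fun_k))"
proof -
  note factor = numerator_factor[OF two_a_plus_1_nonzero fun_a_nonzero(4,5) fun_k_square,
      folded fun_b_eq z0_in_k]
  have F1: "poly F1 x = x^2 + (2 * fun_a + 2 * fun_b + fun_a^2) * x + (2 * fun_a * fun_b + fun_b^2)"
    and F2: "poly F2 x = (2 * fun_a + 1) * x^2 + (fun_a^2 + 2 * fun_a * fun_b + 2 * fun_b) * x + fun_b^2"
    for x by (simp_all add: F1_def F2_def power2_eq_square algebra_simps)
  note factor' = factor[folded F1 F2]
  have "z0 * poly F1 z0 ^ 2 - ?t * poly F2 z0 ^ 2 = 0"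
    using factor'[of z0] by simp
  then show t: "phi z0 = ?t" using poly_F2_z0_nonzero by (simp add: phi_def)
  have "poly numer_phi x = x * poly F1 x ^ 2 - ?t * poly F2 x ^ 2"
    unfolding numer_phi_def t by simp
  also note factor'
  finally show "poly numer_phi x = (x - z0)^2
     * (fun_k^3 / (4 * (3 * fun_a + 4)) * poly (scaled_cubic fun_a) ((x - 1 / 2) / fun_k))" .
qed

definition centred_coord :: "function_field poly" where
  "centred_coord = [: - 1 / (2 * fun_k), 1 / fun_k :]"

lemma poly_centred_coord: "poly centred_coord x = (x - 1 / 2) / fun_k"
  using fun_k_nonzero by (simp add: centred_coord_def field_simps)

lemma g3_eq:
  "g3 = Polynomial.smult (fun_k^3 / (4 * (3 * fun_a + 4))) (pcompose (scaled_cubic fun_a) centred_coord)"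
proof -
  have eq: "numer_phi = [:- z0, 1:]^2
      * Polynomial.smult (fun_k^3 / (4 * (3 * fun_a + 4))) (pcompose (scaled_cubic fun_a) centred_coord)"
    by (simp only: poly_eq_poly_eq_iff[symmetric] fun_eq_iff poly_mult poly_power poly_numer_phi
        poly_smult poly_pcompose poly_centred_coord) simp
  show ?thesis unfolding g3_def eq by (rule nonzero_mult_div_cancel_left) simp
qed

lemma generic_curve_eq:
  "generic_curve = Polynomial.smult (fun_k^5 / (4 * (3 * fun_a + 4)^2))
     (pcompose (scaled_sextic fun_a) centred_coord)"
proof -
  have "poly generic_curve x
     = poly (Polynomial.smult (fun_k^5 / (4 * (3 * fun_a + 4)^2))
         (pcompose (scaled_sextic fun_a) centred_coord)) x" for x
  proof -
    define k m \<eta> c where "k = fun_k" and "m = 3 * fun_a + 4" and "\<eta> = (x - 1 / 2) / k"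
      and "c = poly (scaled_cubic fun_a) \<eta>"
    define l where "l = 4 * (2 * fun_a + 1) * (fun_a - 4)"
    have nz: "k \<noteq> 0" "m \<noteq> 0" using fun_k_nonzero fun_a_nonzero(5) by (simp_all add: k_def m_def)
    have "4 * (l * k^2) = - m" using fun_k_square by (simp only: k_def l_def m_def mult.assoc) simp
    then have m: "m = - (4 * (l * k^2))" by simp
    have x: "x = 1 / 2 + k * \<eta>" using nz by (simp add: \<eta>_def)
    have "k^2 / m * (l + m * \<eta>^2) = l * k^2 / m + (k * \<eta>)^2"
      using nz by (simp add: field_simps)
    also have "l * k^2 / m = - 1 / 4" using nz unfolding m by (simp add: field_simps)
    also have "- 1 / 4 + (k * \<eta>)^2 = x * (x - 1)"
      unfolding x by (simp add: field_simps power2_eq_square)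
    finally have quad: "x * (x - 1) = k^2 / m * (l + m * \<eta>^2)" by simp
    have "poly g3 x = k^3 / (4 * m) * c"
      unfolding k_def m_def \<eta>_def c_def by (simp add: g3_eq poly_pcompose poly_centred_coord)
    moreover have "poly generic_curve x = x * (x - 1) * poly g3 x"
      by (simp add: generic_curve_def algebra_simps)
    ultimately have "poly generic_curve x = x * (x - 1) * (k^3 / (4 * m) * c)" by simp
    also have "\<dots> = k^5 / (4 * m^2) * ((l + m * \<eta>^2) * c)"
      unfolding quad by (simp add: field_simps power2_eq_square eval_nat_numeral)
    also have "\<dots> = k^5 / (4 * m^2) * poly (scaled_sextic fun_a) \<eta>"
    proof -
      have "poly [:l, 0, m:] \<eta> = l + m * \<eta>^2" by (simp add: power2_eq_square)
      then show ?thesis by (simp only: scaled_sextic_def poly_mult c_def l_def m_def)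
    qed
    finally show ?thesis by (simp add: poly_pcompose poly_centred_coord k_def m_def \<eta>_def)
  qed
  then show ?thesis by (simp add: poly_eq_poly_eq_iff[symmetric] fun_eq_iff)
qed

section \<open>The invariants as functions of one parameter\<close>

text \<open>
  The parameter that generates the field of the invariants; it is \<open>v / 4\<close>, written in terms of
  \<open>a\<close> alone (\<open>fun_v_eq\<close>).
\<close>

definition fun_s :: function_field where
  "fun_s = fun_a^2 * (4 - fun_a) / (fun_a + 2)^2"

lemma fun_s_eq: "fun_a^2 * (4 - fun_a) = fun_s * (fun_a + 2)^2"
  using fun_a_nonzero(3) by (simp add: fun_s_def)

text \<open>
  The invariants of the generic curve, up to numerical constants, divided by the factor that
  cancels in the absolute invariants (\<open>generic_curve_invariants\<close>); \<open>reduced_J6\<close> stands for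
  \<open>J2 * J4 - 3 * J6\<close>. A reduced invariant of weight \<open>r\<close> has degree at most \<open>r\<close> in \<open>s\<close>.
\<close>

definition reduced_J2 :: "'a :: comm_ring_1 \<Rightarrow> 'a" where
  "reduced_J2 s = 57 * s^2 - 138 * s + 43"
definition reduced_J4 :: "'a :: comm_ring_1 \<Rightarrow> 'a" where
  "reduced_J4 s = 81 * s^4 + 11880 * s^3 + 1512 * s^2 - 4080 * s + 256"
definition reduced_J6 :: "'a :: comm_ring_1 \<Rightarrow> 'a" where
  "reduced_J6 s = 729 * s^6 - 259524 * s^5 - 2287116 * s^4 + 2420712 * s^3 - 816264 * s^2 + 104256 * s + 4096"
definition reduced_J10 :: "'a :: comm_ring_1 \<Rightarrow> 'a" where
  "reduced_J10 s = s^2 * (2 * s - 1)"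

text \<open>
  \<open>J10_quintic\<close> with the roots 0 and 1. In the centred coordinate these are \<open>\<minusplus> r\<close> with
  \<open>r = 1 / (2 * k)\<close>, where the values of the cubic are conjugate under \<open>k \<mapsto> - k\<close>.
\<close>

lemma J10_generic_curve:
  fixes T W
  defines "T \<equiv> fun_a * (fun_a - 2) * (fun_a + 2)" and "W \<equiv> (fun_a + 2)^2"
  shows "J10 generic_curve = 3888 * fun_k^20 * (T * W)^10 * reduced_J10 fun_s / (3 * fun_a + 4)^10"
proof -
  define a k s m c r l where "a = fun_a" and "k = fun_k" and "s = fun_s" and "m = 3 * a + 4" and
    "c = k^3 / (4 * m)" and "r = 1 / (2 * k)" and "l = 4 * (2 * a + 1) * (a - 4)"
  define n0 n1 n2 where "n0 = poly cubic_coeff0 a" and "n1 = poly cubic_coeff1 a"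
    and "n2 = poly cubic_coeff2 a"
  define X where "X = m * (4 * n0 - l * n2)^2 + l * (4 * n1 + l * 4)^2"
  define D where "D = disc_cubic (scaled_cubic a)"
  have nz: "k \<noteq> 0" "m \<noteq> 0" using fun_k_nonzero fun_a_nonzero(5) by (simp_all add: k_def m_def a_def)
  have lk: "4 * (l * k^2) = - m" using fun_k_square by (simp only: k_def l_def m_def a_def mult.assoc) simp
  then have l: "l = - m / (4 * k^2)" using nz by (simp add: field_simps)
  have r2: "m * r^2 = - l" unfolding l using nz by (simp add: r_def power_divide power_mult_distrib)
  have cubic: "scaled_cubic a = [:4 * n0, - 4 * n1, m * n2, 4 * m:]"
    by (simp only: scaled_cubic_def n0_def n1_def n2_def m_def)
  have C: "poly (scaled_cubic a) t = (4 * n0 + n2 * (m * t^2)) - t * (4 * n1 - 4 * (m * t^2))" for t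
    unfolding cubic by (simp add: algebra_simps power2_eq_square)
  define p q where "p = 4 * n0 - l * n2" and "q = 4 * n1 + l * 4"
  have vals: "poly (scaled_cubic a) (- r) = p + r * q" "poly (scaled_cubic a) r = p - r * q"
    unfolding C power2_minus r2 by (simp_all add: p_def q_def algebra_simps)
  have "m * (poly (scaled_cubic a) (- r) * poly (scaled_cubic a) r) = m * p^2 - (m * r^2) * q^2"
    unfolding vals by (simp add: algebra_simps power2_eq_square)
  also have "\<dots> = X" unfolding r2 X_def p_def q_def by simp
  finally have prod: "poly (scaled_cubic a) (- r) * poly (scaled_cubic a) r = X / m"
    using nz by (simp add: field_simps)
  have g3: "g3 = Polynomial.smult c (pcompose (scaled_cubic a) [: - r, 1 / k:])"
    by (simp add: g3_eq centred_coord_def c_def m_def k_def a_def r_def)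
  have g: "degree g3 = 3" "lead_coeff g3 = 1"
  proof -
    show "degree g3 = 3" by (rule degree_g3)
    have "coeff g3 3 = c * ((1 / k)^3 * (4 * m))"
      unfolding g3 cubic pcompose_cubic by (simp add: numeral_3_eq_3 del: power_Suc)
    then show "lead_coeff g3 = 1" using nz by (simp add: degree_g3 c_def field_simps)
  qed
  have "J10 generic_curve = (0 - 1)^2 * poly g3 0 ^ 2 * poly g3 1 ^ 2 * disc_cubic g3"
    using J10_quintic[OF g, of 0 1] by (simp only: generic_curve_def minus_zero)
  also have "poly g3 0 = c * poly (scaled_cubic a) (- r)"
    by (simp add: g3_eq poly_pcompose poly_centred_coord c_def m_def k_def a_def r_def)
  also have "poly g3 1 = c * poly (scaled_cubic a) r"
    by (simp add: g3_eq poly_pcompose poly_centred_coord c_def m_def k_def a_def r_def)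
  also have "disc_cubic g3 = c^4 * ((1 / k)^6 * D)"
    unfolding g3 D_def cubic by (rule disc_cubic_affine)
  also have "(0 - 1)^2 * (c * poly (scaled_cubic a) (- r))^2 * (c * poly (scaled_cubic a) r)^2 * (c^4 * ((1 / k)^6 * D))
     = c^8 * (poly (scaled_cubic a) (- r) * poly (scaled_cubic a) r)^2 * (D / k^6)"
    by (simp add: power_mult_distrib power_divide)
  also have "\<dots> = k^18 / (65536 * m^10) * (X^2 * D)"
    unfolding prod c_def using nz by (simp add: field_simps)
  also have "X^2 * D = 254803968 * k^2 * T^10 * (W^10 * reduced_J10 s)"
  proof -
    have S: "a^2 * (4 - a) = s * W" using fun_s_eq by (simp only: a_def s_def W_def)
    have "l * X^2 * D = - 63700992 * m * T^10 * ((s * W)^2 * (2 * (s * W) - W) * W^7)"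
      using J10_scaled_sextic[of a, folded m_def, folded l_def n0_def n1_def n2_def, folded X_def D_def]
      unfolding S unfolding T_def W_def a_def by simp
    also have "(s * W)^2 * (2 * (s * W) - W) * W^7 = W^10 * reduced_J10 s"
      by (simp add: reduced_J10_def eval_nat_numeral algebra_simps)
    finally have "- m / (4 * k^2) * (X^2 * D) = - m / (4 * k^2) * (254803968 * k^2 * T^10 * (W^10 * reduced_J10 s))"
      unfolding l using nz by (simp add: field_simps)
    moreover have "- m / (4 * k^2) \<noteq> 0" using nz by simp
    ultimately show ?thesis by (simp only: mult_cancel_left) simp
  qed
  finally show ?thesis
    by (simp add: k_def m_def a_def s_def T_def W_def power_mult_distrib flip: power_add)
qed

text \<open>
  The change to the coordinate \<open>\<eta>\<close> multiplies an invariant of degree \<open>r\<close> by the \<open>r\<close>-th power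
  of one element, and so do the factors \<open>T\<close> and \<open>W\<close> of \<open>J_scaled_sextic\<close>. As all degrees are
  even, \<open>U\<close> absorbs these powers, apart from numerical constants.
\<close>

lemma generic_curve_invariants:
  obtains U where "U \<noteq> 0" "J2 generic_curve = U * reduced_J2 fun_s" "J4 generic_curve = U^2 / 16 * reduced_J4 fun_s"
    "J2 generic_curve * J4 generic_curve - 3 * J6 generic_curve = U^3 / 64 * reduced_J6 fun_s"
    "J10 generic_curve = 243 / 2 * U^5 * reduced_J10 fun_s"
proof
  define a k s m T W where "a = fun_a" and "k = fun_k" and "s = fun_s" and "m = 3 * a + 4"
    and "T = a * (a - 2) * (a + 2)" and "W = (a + 2)^2"
  define \<rho> where "\<rho> = (k^5 / (4 * m^2) * (1 / k)^3)^2"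
  define U where "U = 2 * k^4 * (T * W)^2 / m^2"
  have nz: "k \<noteq> 0" "m \<noteq> 0" "T \<noteq> 0" "W \<noteq> 0"
    using fun_k_nonzero fun_a_nonzero by (simp_all add: k_def m_def a_def T_def W_def)
  then show "U \<noteq> 0" by (simp add: U_def)
  have \<rho>: "U = \<rho> * (32 * (m * T)^2 * W^2)"
    unfolding U_def \<rho>_def using nz by (simp add: field_simps)
  have S: "a^2 * (4 - a) = s * W" using fun_s_eq by (simp only: a_def s_def W_def)
  have T: "m * a * (a - 2) * (a + 2) = m * T" by (simp add: T_def)
  have deg: "degree (scaled_sextic a) \<le> 5" by (simp add: scaled_sextic_pCons)
  have gc: "generic_curve = Polynomial.smult (k^5 / (4 * m^2)) (pcompose (scaled_sextic a) [:- 1 / (2 * k), 1 / k:])"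
    by (simp only: generic_curve_eq centred_coord_def k_def m_def a_def)
  have J2: "J2 generic_curve = \<rho> * J2 (scaled_sextic a)"
    and J4: "J4 generic_curve = \<rho>^2 * J4 (scaled_sextic a)"
    and J6: "J6 generic_curve = \<rho>^3 * J6 (scaled_sextic a)"
    unfolding gc J_affine[OF deg] \<rho>_def by (simp_all flip: power_mult)
  note hom = J_scaled_sextic[of a, folded m_def W_def, unfolded T S]
  have "J2 (scaled_sextic a) = 32 * (m * T)^2 * (W^2 * reduced_J2 s)"
    unfolding hom(1) reduced_J2_def by (simp add: algebra_simps eval_nat_numeral)
  then show "J2 generic_curve = U * reduced_J2 fun_s" by (simp add: J2 \<rho> s_def)
  have "J4 (scaled_sextic a) = 64 * (m * T)^4 * (W^4 * reduced_J4 s)"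
    unfolding hom(2) reduced_J4_def by (simp add: algebra_simps eval_nat_numeral)
  then show "J4 generic_curve = U^2 / 16 * reduced_J4 fun_s"
    by (simp add: J4 \<rho> s_def power_mult_distrib flip: power_mult)
  have "J2 (scaled_sextic a) * J4 (scaled_sextic a) - 3 * J6 (scaled_sextic a) = 512 * (m * T)^6 * (W^6 * reduced_J6 s)"
    unfolding hom(3) reduced_J6_def by (simp add: algebra_simps eval_nat_numeral)
  moreover have "J2 generic_curve * J4 generic_curve - 3 * J6 generic_curve
      = \<rho>^3 * (J2 (scaled_sextic a) * J4 (scaled_sextic a) - 3 * J6 (scaled_sextic a))"
    unfolding J2 J4 J6 by (simp add: algebra_simps power2_eq_square power3_eq_cube)
  ultimately show "J2 generic_curve * J4 generic_curve - 3 * J6 generic_curve = U^3 / 64 * reduced_J6 fun_s"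
    by (simp add: \<rho> s_def power_mult_distrib flip: power_mult)
  show "J10 generic_curve = 243 / 2 * U^5 * reduced_J10 fun_s"
    unfolding J10_generic_curve U_def k_def m_def a_def T_def W_def
    by (simp add: power_mult_distrib power_divide flip: power_mult)
qed

lemma inv_in_s:
  "inv1 = 9 * (reduced_J4 fun_s / reduced_J2 fun_s ^ 2)"
  "inv2 = - 27 * (reduced_J6 fun_s / reduced_J2 fun_s ^ 3)"
  "inv3 = 59049 * (reduced_J10 fun_s / reduced_J2 fun_s ^ 5)"
proof -
  obtain U where U: "U \<noteq> 0" and J: "J2 generic_curve = U * reduced_J2 fun_s" "J4 generic_curve = U^2 / 16 * reduced_J4 fun_s"
    "J2 generic_curve * J4 generic_curve - 3 * J6 generic_curve = U^3 / 64 * reduced_J6 fun_s"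
    "J10 generic_curve = 243 / 2 * U^5 * reduced_J10 fun_s"
    by (rule generic_curve_invariants)
  show "inv1 = 9 * (reduced_J4 fun_s / reduced_J2 fun_s ^ 2)"
    unfolding inv1_def abs_inv1_def J(1,2) using U by (simp add: power_mult_distrib)
  show "inv2 = - 27 * (reduced_J6 fun_s / reduced_J2 fun_s ^ 3)"
    unfolding inv2_def abs_inv2_def J(3) unfolding J(1) using U by (simp add: power_mult_distrib)
  show "inv3 = 59049 * (reduced_J10 fun_s / reduced_J2 fun_s ^ 5)"
    unfolding inv3_def abs_inv3_def J(1,4) using U by (simp add: power_mult_distrib)
qed

section \<open>Recovering the parameter from the absolute invariants\<close>

lemma fun_s_transcendental:
  assumes "poly (map_poly const p) fun_s = 0"
  shows "p = 0"
proof (rule ccontr)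
  assume "p \<noteq> 0"
  then obtain c where c: "fun_s = const c" using algebraic_imp_constant assms by blast
  have "poly (map_poly const [:- 4 * c, - 4 * c, 4 - c, - 1:]) fun_a
      = fun_a^2 * (4 - fun_a) - const c * (fun_a + 2)^2"
    by (simp add: algebra_simps power2_eq_square const.hom_uminus const.hom_mult const.hom_minus const.hom_numeral)
  also have "\<dots> = 0" by (simp add: fun_s_eq c)
  finally have "[:- 4 * c, - 4 * c, 4 - c, - 1:] = 0" by (rule fun_a_transcendental)
  then show False by simp
qed

text \<open>
  Isobaric forms of weight 14 in quantities of weight 2, 4, 6 and 10. There are ten monomials
  of this weight, and for two such forms \<open>P\<close> and \<open>Q\<close>, evaluated at the reduced invariants,
  \<open>s * Q - P\<close> is a polynomial in \<open>s\<close> of degree at most 15. So \<open>s * Q = P\<close> imposes 16 linear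
  conditions on 20 coefficients. The coefficients below are a short vector in the lattice of
  integer solutions. That \<open>Q\<close> does not vanish at the reduced invariants is
  \<open>s_denominators_nonzero\<close>.
\<close>

definition s_numerator :: "'a :: comm_ring_1 \<Rightarrow> 'a \<Rightarrow> 'a \<Rightarrow> 'a \<Rightarrow> 'a" where
  "s_numerator w x y z =
    424579788582574563433354752000 * w^7 - 77498933589154299185133080267443273200 * w^2 * z -
    2238646433986246489994380033602 * w^4 * y + 5519657720440537000543056491590 * w * y^2 -
    3376374148181697652503830273040 * w^5 * x + 46066823427303520786503263327852402250 * x * z +
    8369310061676174163874011474734 * w^2 * x * y + 4902992701432272203555239760586 * w^3 * x^2
    + 880288869680794851199297421660 * x^2 * y - 4138007249970437394030459165512 * w * x^3"

definition s_denominator :: "'a :: comm_ring_1 \<Rightarrow> 'a \<Rightarrow> 'a \<Rightarrow> 'a \<Rightarrow> 'a" where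
  "s_denominator w x y z =
    - 169712301311020983766299753600 * w^7 - 42460619517571378773453240975336786600 * w^2 * z +
    13390038179561155193944214175891 * w^4 * y + 15263068107722088632911179542220 * w * y^2 +
    4241724846007492488712806810540 * w^5 * x + 343619395828441340794956644684930944875 * x * z
    + 9090999679448719777491042490302 * w^2 * x * y + 16625904554464506700655845099032 * w^3 *
    x^2 + 429897355876196850037709082455 * x^2 * y - 13520579530635769104801941746616 * w * x^3"

lemma s_isobaric:
  fixes d x y z :: "'a :: field_char_0"
  shows "s_numerator d (x * d^2) (y * d^3) (z * d^5) = d^7 * s_numerator 1 x y z"
    and "s_denominator d (x * d^2) (y * d^3) (z * d^5) = d^7 * s_denominator 1 x y z"
  unfolding s_numerator_def s_denominator_def by (simp_all add: algebra_simps eval_nat_numeral)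

lemma reduced_poly:
  "reduced_J2 s = poly [:43, - 138, 57:] s"
  "reduced_J4 s = poly [:256, - 4080, 1512, 11880, 81:] s"
  "reduced_J6 s = poly [:4096, 104256, - 816264, 2420712, - 2287116, - 259524, 729:] s"
  "reduced_J10 s = poly [:0, 0, - 1, 2:] s"
  unfolding reduced_J2_def reduced_J4_def reduced_J6_def reduced_J10_def
  by (simp_all add: algebra_simps eval_nat_numeral)

lemma poly_s_forms:
  "poly (s_numerator w x y z) t = s_numerator (poly w t) (poly x t) (poly y t) (poly z t)"
  "poly (s_denominator w x y z) t = s_denominator (poly w t) (poly x t) (poly y t) (poly z t)"
  by (simp_all add: s_numerator_def s_denominator_def)

lemma s_quotient:
  fixes s :: "'a :: idom"
  shows "s * s_denominator (reduced_J2 s) (reduced_J4 s) (reduced_J6 s) (reduced_J10 s)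
    = s_numerator (reduced_J2 s) (reduced_J4 s) (reduced_J6 s) (reduced_J10 s)"
proof -
  let ?w = "[:43, - 138, 57:] :: 'a poly" and ?x = "[:256, - 4080, 1512, 11880, 81:] :: 'a poly"
    and ?y = "[:4096, 104256, - 816264, 2420712, - 2287116, - 259524, 729:] :: 'a poly"
    and ?z = "[:0, 0, - 1, 2:] :: 'a poly"
  have "[:0, 1:] * s_denominator ?w ?x ?y ?z = s_numerator ?w ?x ?y ?z"
    unfolding s_numerator_def s_denominator_def by (simp add: numeral_poly eval_nat_numeral)
  then have "poly ([:0, 1:] * s_denominator ?w ?x ?y ?z) s = poly (s_numerator ?w ?x ?y ?z) s"
    by (rule arg_cong)
  moreover have "poly [:0, 1:] s = s" by simp
  ultimately show ?thesis by (simp only: poly_mult poly_s_forms reduced_poly)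
qed

text \<open>
  Both are nonzero polynomials in the transcendental element \<open>s\<close>, as their values at \<open>s = 0\<close>
  show.
\<close>

lemma s_denominators_nonzero:
  "reduced_J2 fun_s \<noteq> 0"
  "s_denominator (reduced_J2 fun_s) (reduced_J4 fun_s) (reduced_J6 fun_s) (reduced_J10 fun_s) \<noteq> 0"
proof -
  interpret ev: comm_ring_hom "\<lambda>p. poly (map_poly const p) fun_s"
    by (rule eval_hom[OF const.comm_ring_hom_axioms])
  let ?X = "[:0, 1:] :: complex poly"
  have X: "poly (map_poly const ?X) fun_s = fun_s" by simp
  have n: "poly (map_poly const (reduced_J2 ?X)) fun_s = reduced_J2 fun_s"
    "poly (map_poly const (reduced_J4 ?X)) fun_s = reduced_J4 fun_s"
    "poly (map_poly const (reduced_J6 ?X)) fun_s = reduced_J6 fun_s"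
    "poly (map_poly const (reduced_J10 ?X)) fun_s = reduced_J10 fun_s"
    unfolding reduced_J2_def reduced_J4_def reduced_J6_def reduced_J10_def
    by (simp_all only: ev.hom_add ev.hom_minus ev.hom_mult ev.hom_power ev.hom_numeral ev.hom_one X)
  have d: "poly (map_poly const (s_denominator (reduced_J2 ?X) (reduced_J4 ?X) (reduced_J6 ?X) (reduced_J10 ?X))) fun_s
      = s_denominator (reduced_J2 fun_s) (reduced_J4 fun_s) (reduced_J6 fun_s) (reduced_J10 fun_s)"
    unfolding s_denominator_def
    by (simp only: ev.hom_add ev.hom_minus ev.hom_uminus ev.hom_mult ev.hom_power ev.hom_numeral n)
  have "poly (reduced_J2 ?X) 0 \<noteq> 0" by (simp add: reduced_J2_def)
  moreover have "poly (s_denominator (reduced_J2 ?X) (reduced_J4 ?X) (reduced_J6 ?X) (reduced_J10 ?X)) 0 \<noteq> 0"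
    by (simp add: s_denominator_def reduced_J2_def reduced_J4_def reduced_J6_def reduced_J10_def)
  ultimately show "reduced_J2 fun_s \<noteq> 0"
    "s_denominator (reduced_J2 fun_s) (reduced_J4 fun_s) (reduced_J6 fun_s) (reduced_J10 fun_s) \<noteq> 0"
    using fun_s_transcendental n(1) d by (metis poly_0)+
qed

text \<open>
  The absolute invariants are, up to constants, the reduced invariants divided by powers of
  \<open>reduced_J2\<close>. A quotient of two isobaric forms of the same weight can therefore be computed
  from them.
\<close>

lemma fun_s_in_invariants:
  "fun_s = s_numerator 1 (inv1 / 9) (- inv2 / 27) (inv3 / 59049)
     / s_denominator 1 (inv1 / 9) (- inv2 / 27) (inv3 / 59049)"
proof -
  define d x y z where "d = reduced_J2 fun_s" and "x = inv1 / 9" and "y = - inv2 / 27" and "z = inv3 / 59049"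
  have d: "d \<noteq> 0" using s_denominators_nonzero(1) by (simp add: d_def)
  then have n: "reduced_J4 fun_s = x * d^2" "reduced_J6 fun_s = y * d^3" "reduced_J10 fun_s = z * d^5"
    by (simp_all add: x_def y_def z_def inv_in_s d_def)
  have "d^7 * s_denominator 1 x y z \<noteq> 0"
    using s_denominators_nonzero(2) by (simp only: n d_def[symmetric] s_isobaric not_False_eq_True)
  moreover have "fun_s * (d^7 * s_denominator 1 x y z) = d^7 * s_numerator 1 x y z"
    using s_quotient[of fun_s] by (simp only: n d_def[symmetric] s_isobaric)
  ultimately have "s_denominator 1 x y z \<noteq> 0" "fun_s * s_denominator 1 x y z = s_numerator 1 x y z"
    using d by simp_all
  then show ?thesis unfolding x_def[symmetric] y_def[symmetric] z_def[symmetric]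
    by (simp add: eq_divide_eq)
qed

section \<open>The function field\<close>

text \<open>
  This is how \<open>a\<close> alone determines \<open>b * (a + b + 1)\<close>, the common denominator of \<open>u\<close> and \<open>v\<close>.
\<close>

lemma curve_in_product:
  fixes a b :: "'a :: comm_ring_1"
  shows "4 * (a - 4) * (b * (a + b + 1)) + a * (a + 2)^2
    = a^3 + 4 * b * a^2 + 4 * a^2 - 12 * b * a + 4 * a * b^2 + 4 * a - 16 * b - 16 * b^2"
  by (simp add: algebra_simps eval_nat_numeral)

lemma fun_v_eq: "fun_v = 4 * fun_s"
  and fun_u_eq: "fun_u = 8 - 2 * fun_s"
proof -
  define w where "w = fun_b * (fun_a + fun_b + 1)"
  have "4 * (fun_a - 4) * w + fun_a * (fun_a + 2)^2 = 0"
    unfolding w_def curve_in_product by (rule curve_equation)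
  then have "fun_a * (fun_a + 2)^2 = - (4 * (fun_a - 4) * w)"
    by (subst (asm) add.commute) (simp only: eq_neg_iff_add_eq_0)
  also have "\<dots> = 4 * (4 - fun_a) * w" by (simp add: algebra_simps)
  finally have w4: "fun_a * (fun_a + 2)^2 = 4 * (4 - fun_a) * w" .
  moreover have "fun_a * (fun_a + 2)^2 \<noteq> 0" using fun_a_nonzero by simp
  ultimately have w: "w \<noteq> 0" by auto
  have "fun_a^3 * (fun_a + 2)^2 = fun_a^2 * (fun_a * (fun_a + 2)^2)"
    by (simp add: power2_eq_square power3_eq_cube)
  also have "\<dots> = 4 * (fun_a^2 * (4 - fun_a)) * w"
    unfolding w4 by (simp add: mult_ac)
  also have "\<dots> = 4 * fun_s * w * (fun_a + 2)^2" unfolding fun_s_eq by simp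
  finally have v: "fun_a^3 = 4 * fun_s * w" using fun_a_nonzero(3) by simp
  then show fun_v: "fun_v = 4 * fun_s" unfolding fun_v_def w_def[symmetric] using w by simp
  have "4 * (fun_a * (fun_a * fun_b + fun_b^2 + fun_b + fun_a + 1)) + fun_a^3 - 16 * w = 0"
    using curve_equation unfolding w_def by (simp add: algebra_simps power2_eq_square power3_eq_cube)
  then have "2 * (2 * fun_a * (fun_a * fun_b + fun_b^2 + fun_b + fun_a + 1)) = 2 * ((8 - 2 * fun_s) * w)"
    unfolding v by (simp add: algebra_simps)
  then show "fun_u = 8 - 2 * fun_s"
    unfolding fun_u_def w_def[symmetric] using w by (simp only: mult_cancel_left) (simp add: divide_eq_eq)
qed

lemma function_field_Y3_eq: "function_field_Y3 = adjoin_C {fun_u, fun_v}"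
  and fun_s_mem: "fun_s \<in> adjoin_C {inv1, inv2, inv3}"
proof -
  let ?L = "adjoin_C {inv1, inv2, inv3}" and ?M = "adjoin_C {fun_u, fun_v}"
  note L = subfield_closed[OF subfield_adjoin_C] subfield_closed_derived[OF subfield_adjoin_C]
  have "inv1 \<in> ?L" "inv2 \<in> ?L" "inv3 \<in> ?L" using adjoin_C_superset[of "{inv1, inv2, inv3}"] by simp_all
  then show s: "fun_s \<in> ?L"
    by (subst fun_s_in_invariants) (simp add: s_numerator_def s_denominator_def L)
  have "fun_v \<in> ?M" using adjoin_C_superset[of "{fun_u, fun_v}"] by simp
  then have "fun_v / 4 \<in> ?M" by (intro L)
  then have s': "fun_s \<in> ?M" by (simp add: fun_v_eq)
  have "{fun_u, fun_v} \<subseteq> ?L" using s by (simp add: fun_u_eq fun_v_eq L)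
  moreover have "{inv1, inv2, inv3} \<subseteq> ?M"
    using s' by (simp add: inv_in_s reduced_J2_def reduced_J4_def reduced_J6_def reduced_J10_def L)
  ultimately show "function_field_Y3 = ?M"
    unfolding function_field_Y3_def
    by (intro equalityI adjoin_C_least subfield_adjoin_C)
qed

theorem proposition6:
  shows "2 * fun_u + fun_v - 16 = 0 \<and>
         function_field_Y3 = adjoin_C {fun_u, fun_v} \<and>
         rational_function_of fun_u inv1 inv2 inv3 \<and>
         rational_function_of fun_v inv1 inv2 inv3"
proof -
  note L = subfield_closed[OF subfield_adjoin_C] subfield_closed_derived[OF subfield_adjoin_C]
  have "2 * fun_u + fun_v - 16 = 0" by (simp add: fun_u_eq fun_v_eq)
  moreover have "fun_u \<in> adjoin_C {inv1, inv2, inv3}" "fun_v \<in> adjoin_C {inv1, inv2, inv3}"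
    using fun_s_mem by (simp_all add: fun_u_eq fun_v_eq L)
  ultimately show ?thesis
    using function_field_Y3_eq adjoin_C_imp_rational_function by simp
qed

end
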